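(* There is an absolute constant $C$ such that the following holds. Suppose that $P$ and $Q$ are simple polygons in the plane, in general position, with $m$ and $n$ sides, respectively, where $m,n\ge 3$ are odd numbers. Then there are at least $m+n-C$ pairs $(p,q)$, with $p$ a side of $P$ and $q$ a side of $Q$, that do not intersect. Hence, there are at most $mn-(m+n)+C$ intersection points between the boundary of $P$ and the boundary of $Q$.
   Context: A polygon is regarded as a closed piecewise linear curve (its boundary); the enclosed region is disregarded. Sides are closed line segments. A polygon is simple if its sides are pairwise disjoint except for the common endpoints of cyclically consecutive sides. General position means: no three of the $m+n$ vertices of $P$ and $Q$ combined lie on a line, and no two sides of $P$ and $Q$ combined are parallel. A side of $P$ and a side of $Q$ do not intersect if they are disjoint as closed segments. *)

theory Defs
  imports "HOL-Analysis.Analysis"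
begin

text \<open>A polygon with \<open>m\<close> sides is given by the list of its \<open>m\<close> vertices in cyclic order.\<close>

definition next_vertex :: "(real^2) list \<Rightarrow> nat \<Rightarrow> real^2" where
  "next_vertex P i = P ! (Suc i mod length P)"

definition side :: "(real^2) list \<Rightarrow> nat \<Rightarrow> (real^2) set" where
  "side P i = closed_segment (P ! i) (next_vertex P i)"

definition sides :: "(real^2) list \<Rightarrow> (real^2) set set" where
  "sides P = side P ` {..<length P}"

definition boundary :: "(real^2) list \<Rightarrow> (real^2) set" where
  "boundary P = \<Union> (sides P)"

definition simple_polygon :: "(real^2) list \<Rightarrow> bool" where
  "simple_polygon P \<longleftrightarrow>
     3 \<le> length P \<and> distinct P \<and>
     (\<forall>i<length P. \<forall>j<length P. i \<noteq> j \<longrightarrow>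
        side P i \<inter> side P j =
          (if j = Suc i mod length P then {P ! j}
           else if i = Suc j mod length P then {P ! i}
           else {}))"

definition side_vectors :: "(real^2) list \<Rightarrow> (real^2) list" where
  "side_vectors P = map (\<lambda>i. next_vertex P i - P ! i) [0..<length P]"

text \<open>Two segments are parallel iff their direction vectors are linearly dependent, that is,
  collinear with the origin.  The distinctness condition says that the vertices of \<open>P\<close> and \<open>Q\<close>
  combined really are \<open>m + n\<close> points.\<close>

definition general_position :: "(real^2) list \<Rightarrow> (real^2) list \<Rightarrow> bool" where
  "general_position P Q \<longleftrightarrow>
     distinct (P @ Q) \<and>
     (\<forall>a\<in>set (P @ Q). \<forall>b\<in>set (P @ Q). \<forall>c\<in>set (P @ Q).
        distinct [a, b, c] \<longrightarrow> \<not> collinear {a, b, c}) \<and>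
     (let D = side_vectors P @ side_vectors Q in
        \<forall>i<length D. \<forall>j<length D. i \<noteq> j \<longrightarrow> \<not> collinear {0, D ! i, D ! j})"

end

theory Submission imports Defs "HOL-Library.Ramsey" begin

text \<open>
  Join a side of \<open>P\<close> to a side of \<open>Q\<close> when they are disjoint.  This bipartite graph has \<open>m + n\<close>
  vertices, and a graph has at least as many edges as it has vertices minus connected components, so
  it is enough to bound the number of components by an absolute constant.  Instead of components,
  the proof uses a labelling of the sides that is constant along edges
  (\<open>labelling_with_few_edges\<close>): two sides of different polygons with different labels meet.

  Oddness enters through parity.  If every side of \<open>Q\<close> met a side \<open>p\<close> of \<open>P\<close>, then the vertices of
  \<open>Q\<close> would alternate between the two sides of the line of \<open>p\<close>, which an odd cycle cannot do; so
  every side has a partner that it misses.  A refinement of this argument (\<open>hooked_corner\<close>) treats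
  two consecutive sides \<open>a\<close>, \<open>b\<close> of \<open>P\<close> with different labels, where each side of \<open>Q\<close> meets at
  least one of the two: there are consecutive sides \<open>c\<close>, \<open>d\<close> of \<open>Q\<close>, in one order or the other, such
  that \<open>c\<close> misses \<open>a\<close> and \<open>d\<close> misses \<open>b\<close>.  Call this a hook.  Then \<open>c\<close> has the label of \<open>a\<close> and
  \<open>d\<close> has the label of \<open>b\<close>; in particular \<open>c\<close> meets \<open>b\<close> and \<open>d\<close> meets \<open>a\<close>.

  With many labels there are many hooks: for each label \<open>\<kappa>\<close> the cyclic sequence of sides of \<open>P\<close>
  leaves \<open>\<kappa>\<close> somewhere, so there is a hook in which \<open>a\<close> and \<open>c\<close> have the label \<open>\<kappa>\<close> and \<open>b\<close> and
  \<open>d\<close> do not.  A hook has six corners: the common vertex \<open>v\<close> of \<open>a\<close> and \<open>b\<close> with the other ends of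
  \<open>a\<close> and \<open>b\<close>, and the common vertex \<open>u\<close> of \<open>c\<close> and \<open>d\<close> with the other ends of \<open>c\<close> and \<open>d\<close>.
  Ramsey's theorem for pairs yields three hooks such that the orientations of the triangles formed by
  corners of two of them depend only on the names of the corners and not on the choice of the two
  hooks.  It also makes them share no vertices and makes the labels of \<open>b\<close> and \<open>d\<close> in one hook differ
  from the label of \<open>a\<close> and \<open>c\<close> in another.  Among these three hooks, \<open>a\<close> misses the \<open>c\<close> of its own
  hook and meets the two other sides named \<open>c\<close>, \<open>a\<close> meets every \<open>d\<close>, \<open>b\<close> meets every \<open>c\<close>, and
  \<open>b\<close> misses the \<open>d\<close> of its own hook.  The sides of one polygon that belong to different hooks are
  disjoint.

  Such a configuration of eighteen points does not exist (\<open>no_homogeneous_hooked_triple\<close>).  This is a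
  statement about orientations only, because in general position the orientations of triangles decide
  which segments meet.  It already follows from a few hundred instances of two elementary rules
  for points in the plane: if \<open>a\<close> lies inside a triangle, then the corners appear around the triangle
  in the same rotational sense as they appear around \<open>a\<close>, and no line through \<open>a\<close> has all corners on
  one side.  These instances and the conditions on the sides are jointly unsatisfiable as a
  propositional formula; the list of instances was found by a computer search, and propositional
  resolution refutes it.
\<close>

section \<open>Orientations and crossing segments\<close>

text \<open>
  Twice the signed area of the triangle.
\<close>

definition orient :: "real^2 \<Rightarrow> real^2 \<Rightarrow> real^2 \<Rightarrow> real" where
  "orient p q r = (q $ 1 - p $ 1) * (r $ 2 - p $ 2) - (q $ 2 - p $ 2) * (r $ 1 - p $ 1)"

abbreviation ccw :: "real^2 \<Rightarrow> real^2 \<Rightarrow> real^2 \<Rightarrow> bool" where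
  "ccw p q r \<equiv> 0 < orient p q r"

lemma orient_rotate: "orient q r p = orient p q r"
  and orient_swap: "orient q p r = - orient p q r"
  by (simp_all add: orient_def algebra_simps)

lemma orient_eq_0_iff_collinear: "orient p q r = 0 \<longleftrightarrow> collinear {p, q, r}"
proof -
  have "collinear {p, q, r} \<longleftrightarrow> collinear {0, q - p, r - p}"
    using collinear_3[of q p r] by (simp add: insert_commute)
  also have "\<dots> \<longleftrightarrow> orient p q r = 0"
  proof
    assume "collinear {0, q - p, r - p}"
    then consider "q - p = 0" | "r - p = 0" | c where "r - p = c *\<^sub>R (q - p)"
      unfolding collinear_lemma by blast
    then show "orient p q r = 0"
    proof cases
      case 3
      then have "r $ i - p $ i = c * (q $ i - p $ i)" for i
        by (metis vector_minus_component vector_scaleR_component real_scaleR_def)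
      then have "r $ 1 = p $ 1 + c * (q $ 1 - p $ 1)" "r $ 2 = p $ 2 + c * (q $ 2 - p $ 2)"
        by (metis add.commute diff_add_cancel)+
      then show ?thesis by (simp add: orient_def)
    qed (auto simp: orient_def)
  next
    assume 0: "orient p q r = 0"
    show "collinear {0, q - p, r - p}"
    proof (cases "q $ 1 = p $ 1 \<and> q $ 2 = p $ 2")
      case True
      then have "q - p = 0" by (simp add: vec_eq_iff forall_2)
      then show ?thesis by simp
    next
      case False
      define c where "c = (if q $ 1 = p $ 1 then (r $ 2 - p $ 2) / (q $ 2 - p $ 2)
                           else (r $ 1 - p $ 1) / (q $ 1 - p $ 1))"
      have "r - p = c *\<^sub>R (q - p)"
      proof (cases "q $ 1 = p $ 1")
        case True
        then have "q $ 2 \<noteq> p $ 2" using False by simp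
        moreover from this have "r $ 1 = p $ 1" using 0 True by (simp add: orient_def)
        ultimately show ?thesis using True by (simp add: vec_eq_iff forall_2 c_def)
      next
        case ne: False
        then have "r $ 2 - p $ 2 = (r $ 1 - p $ 1) / (q $ 1 - p $ 1) * (q $ 2 - p $ 2)"
          using 0 by (simp add: orient_def field_simps)
        then show ?thesis using ne by (simp add: vec_eq_iff forall_2 c_def)
      qed
      then show ?thesis unfolding collinear_lemma by blast
    qed
  qed
  finally show ?thesis ..
qed

lemma orient_convex:
  "orient p q ((1 - t) *\<^sub>R r + t *\<^sub>R s) = (1 - t) * orient p q r + t * orient p q s"
  by (simp add: orient_def algebra_simps)

text \<open>
  Each segment has its ends on different sides of the line of the other.  The orientation is a
  parameter because the finite argument below applies the notion to abstract orientations.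
\<close>

definition crosses :: "('a \<Rightarrow> 'a \<Rightarrow> 'a \<Rightarrow> bool) \<Rightarrow> 'a \<Rightarrow> 'a \<Rightarrow> 'a \<Rightarrow> 'a \<Rightarrow> bool" where
  "crosses X p q r s \<longleftrightarrow> X p q r \<noteq> X p q s \<and> X r s p \<noteq> X r s q"

text \<open>
  If the segments share a point, that point is a convex combination of ends with orientation zero, so
  the ends have different signs.  Conversely, the crossing point divides each segment in the ratio of
  the orientations of its ends.
\<close>

lemma segments_meet_iff_crosses:
  assumes "orient p q r \<noteq> 0" "orient p q s \<noteq> 0" "orient r s p \<noteq> 0" "orient r s q \<noteq> 0"
  shows "closed_segment p q \<inter> closed_segment r s \<noteq> {} \<longleftrightarrow> crosses ccw p q r s"
proof
  assume "closed_segment p q \<inter> closed_segment r s \<noteq> {}"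
  then obtain t u where t: "0 \<le> t" "t \<le> 1" and u: "0 \<le> u" "u \<le> 1"
    and eq: "(1 - t) *\<^sub>R p + t *\<^sub>R q = (1 - u) *\<^sub>R r + u *\<^sub>R s"
    by (auto simp: in_segment)
  have pos: "0 < (1 - x) * A + x * B" if "0 < A" "0 < B" "0 \<le> x" "x \<le> 1" for x A B :: real
    using that by (cases "x = 0") (auto intro!: add_nonneg_pos)
  have same_side: "ccw a b c \<noteq> ccw a b d"
    if 0: "(1 - x) * orient a b c + x * orient a b d = 0" and x: "0 \<le> x" "x \<le> 1"
      and nz: "orient a b c \<noteq> 0" "orient a b d \<noteq> 0" for a b c d x
  proof
    assume *: "ccw a b c = ccw a b d"
    consider "0 < orient a b c" "0 < orient a b d" | "0 < - orient a b c" "0 < - orient a b d"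
      using * nz by (cases "ccw a b c") (auto simp: not_less less_le)
    then show False
    proof cases
      case 1
      then show False using pos[OF 1 x] 0 by simp
    next
      case 2
      have "(1 - x) * - orient a b c + x * - orient a b d = 0" using 0 by simp
      then show False using pos[OF 2 x] by linarith
    qed
  qed
  have on_line: "orient x y ((1 - z) *\<^sub>R x + z *\<^sub>R y) = 0" for x y z
    unfolding orient_convex by (simp add: orient_def)
  have "(1 - u) * orient p q r + u * orient p q s = 0"
    using on_line[of p q t] unfolding eq orient_convex .
  moreover have "(1 - t) * orient r s p + t * orient r s q = 0"
    using on_line[of r s u] unfolding eq[symmetric] orient_convex .
  ultimately show "crosses ccw p q r s"
    unfolding crosses_def using same_side t u assms by blast
next
  assume cr: "crosses ccw p q r s"
  have ratio: "0 \<le> A / (A - B) \<and> A / (A - B) \<le> 1" if sg: "(0 < A) \<noteq> (0 < B)" for A B :: real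
  proof (cases "0 < A")
    case True
    with sg have "0 < A - B" "B \<le> 0" by auto
    with True show ?thesis by simp
  next
    case False
    with sg have "A - B < 0" "0 < B" by auto
    with False show ?thesis by (simp add: divide_nonpos_neg)
  qed
  define D where "D = orient p q r - orient p q s"
  have D': "orient r s p - orient r s q = - D"
    unfolding D_def orient_def by (simp add: algebra_simps)
  have D0: "D \<noteq> 0" using cr unfolding D_def crosses_def by auto
  define u where "u = orient p q r / D"
  define t where "t = orient r s p / (- D)"
  have u: "0 \<le> u" "u \<le> 1" and t: "0 \<le> t" "t \<le> 1"
    using cr ratio[of "orient p q r" "orient p q s"] ratio[of "orient r s p" "orient r s q"]
    unfolding u_def t_def D'[symmetric] crosses_def by (simp_all add: D_def)
  have "((1 - t) *\<^sub>R p + t *\<^sub>R q) $ i = ((1 - u) *\<^sub>R r + u *\<^sub>R s) $ i" for i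
  proof -
    have "D * p $ i - orient r s p * (q $ i - p $ i) = D * r $ i + orient p q r * (s $ i - r $ i)"
      unfolding D_def orient_def using exhaust_2[of i] by (auto simp: algebra_simps)
    moreover have "t * D = - orient r s p" "u * D = orient p q r"
      using D0 by (simp_all add: t_def u_def)
    ultimately have "D * ((1 - t) * p $ i + t * q $ i) = D * ((1 - u) * r $ i + u * s $ i)"
      by algebra
    then show ?thesis using D0 by simp
  qed
  then have "(1 - t) *\<^sub>R p + t *\<^sub>R q = (1 - u) *\<^sub>R r + u *\<^sub>R s"
    by (simp add: vec_eq_iff)
  then have "(1 - t) *\<^sub>R p + t *\<^sub>R q \<in> closed_segment p q \<inter> closed_segment r s"
    using t u by (auto simp: in_segment)
  then show "closed_segment p q \<inter> closed_segment r s \<noteq> {}" by blast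
qed

lemma segments_meet_once:
  assumes "orient p q r \<noteq> 0"
    and x: "x \<in> closed_segment p q \<inter> closed_segment r s" and y: "y \<in> closed_segment p q \<inter> closed_segment r s"
  shows "x = y"
proof -
  obtain u where u: "x = (1 - u) *\<^sub>R r + u *\<^sub>R s" using x by (auto simp: in_segment)
  obtain v where v: "y = (1 - v) *\<^sub>R r + v *\<^sub>R s" using y by (auto simp: in_segment)
  have on_line: "orient p q z = 0" if z: "z \<in> closed_segment p q" for z
  proof -
    obtain t where "z = (1 - t) *\<^sub>R p + t *\<^sub>R q" using z by (auto simp: in_segment)
    then show ?thesis by (simp only: orient_convex) (simp add: orient_def)
  qed
  have "(1 - u) * orient p q r + u * orient p q s = 0" "(1 - v) * orient p q r + v * orient p q s = 0"
    using on_line[of x] on_line[of y] x y unfolding u v orient_convex by blast+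
  then have "(u - v) * orient p q r = 0" by algebra
  then have "u = v" using assms(1) by simp
  then show ?thesis using u v by simp
qed

section \<open>Abstract orientations\<close>

text \<open>
  These are the properties of the orientation of plane triangles that the finite argument uses.  The
  premises \<open>X a b c\<close>, \<open>X a c d\<close>, \<open>X a d b\<close> say that \<open>b\<close>, \<open>c\<close>, \<open>d\<close> appear counterclockwise around
  \<open>a\<close> with all gaps less than a half-turn, that is, \<open>a\<close> lies inside the triangle \<open>b c d\<close>.  Then the
  triangle is counterclockwise, and the line through \<open>a\<close> and \<open>e\<close> separates its corners.
\<close>

locale chirotope =
  fixes S :: "'a set" and X :: "'a \<Rightarrow> 'a \<Rightarrow> 'a \<Rightarrow> bool"
  assumes rotate: "\<lbrakk>{a, b, c} \<subseteq> S; distinct [a, b, c]\<rbrakk> \<Longrightarrow> X b c a = X a b c"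
    and swap: "\<lbrakk>{a, b, c} \<subseteq> S; distinct [a, b, c]\<rbrakk> \<Longrightarrow> X b a c = (\<not> X a b c)"
    and interior: "\<lbrakk>{a, b, c, d} \<subseteq> S; distinct [a, b, c, d]; X a b c; X a c d; X a d b\<rbrakk> \<Longrightarrow> X b c d"
    and pencil: "\<lbrakk>{a, b, c, d, e} \<subseteq> S; distinct [a, b, c, d, e]; X a b c; X a c d; X a d b\<rbrakk>
      \<Longrightarrow> \<not> (X a b e \<and> X a c e \<and> X a d e) \<and> \<not> (X a e b \<and> X a e c \<and> X a e d)"

text \<open>
  The rule \<open>interior\<close> holds because the signed area of a triangle is the sum of the areas that its
  edges span with \<open>a\<close>.  The rule \<open>pencil\<close> is the three-term Grassmann-Pluecker relation: a sum of
  three products of orientations vanishes, so the products cannot all have the same sign.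
\<close>

lemma chirotope_ccw:
  assumes "\<And>i j k. \<lbrakk>{i, j, k} \<subseteq> S; distinct [i, j, k]\<rbrakk> \<Longrightarrow> orient (f i) (f j) (f k) \<noteq> 0"
  shows "chirotope S (\<lambda>i j k. ccw (f i) (f j) (f k))"
proof
  fix a b c d e
  show "ccw (f b) (f c) (f a) = ccw (f a) (f b) (f c)" by (simp add: orient_rotate)
  show "ccw (f b) (f a) (f c) = (\<not> ccw (f a) (f b) (f c))"
    if "{a, b, c} \<subseteq> S" "distinct [a, b, c]"
    using assms[OF that] orient_swap[of "f b" "f a" "f c"] by auto
  assume in3: "ccw (f a) (f b) (f c)" "ccw (f a) (f c) (f d)" "ccw (f a) (f d) (f b)"
  have "orient (f b) (f c) (f d) = orient (f a) (f b) (f c) + orient (f a) (f c) (f d) + orient (f a) (f d) (f b)"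
    by (simp add: orient_def algebra_simps)
  then show "ccw (f b) (f c) (f d)" using in3 by simp
  have gp: "orient (f a) (f b) (f c) * orient (f a) (f d) (f e)
      + orient (f a) (f c) (f d) * orient (f a) (f b) (f e)
      + orient (f a) (f d) (f b) * orient (f a) (f c) (f e) = 0"
    by (simp add: orient_def algebra_simps)
  have "\<not> (ccw (f a) (f b) (f e) \<and> ccw (f a) (f c) (f e) \<and> ccw (f a) (f d) (f e))"
    using gp in3 by (metis add_pos_pos less_irrefl mult_pos_pos)
  moreover have "\<not> (ccw (f a) (f e) (f b) \<and> ccw (f a) (f e) (f c) \<and> ccw (f a) (f e) (f d))"
  proof
    assume *: "ccw (f a) (f e) (f b) \<and> ccw (f a) (f e) (f c) \<and> ccw (f a) (f e) (f d)"
    have neg: "orient (f a) x (f e) < 0" if "ccw (f a) (f e) x" for x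
      using that by (simp add: orient_def algebra_simps)
    have "orient (f a) (f b) (f c) * orient (f a) (f d) (f e)
      + orient (f a) (f c) (f d) * orient (f a) (f b) (f e)
      + orient (f a) (f d) (f b) * orient (f a) (f c) (f e) < 0"
      using in3 neg * by (intro add_neg_neg mult_pos_neg) auto
    then show False using gp by simp
  qed
  ultimately show "\<not> (ccw (f a) (f b) (f e) \<and> ccw (f a) (f c) (f e) \<and> ccw (f a) (f d) (f e))
    \<and> \<not> (ccw (f a) (f e) (f b) \<and> ccw (f a) (f e) (f c) \<and> ccw (f a) (f e) (f d))" by blast
qed

lemma (in chirotope) chirotope_reflect: "chirotope S (\<lambda>a b c. X b a c)"
proof
  fix a b c d e
  have rot: "X q p r = X p r q" if "{p, q, r} \<subseteq> S" "distinct [p, q, r]" for p q r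
    using rotate[of q p r] that by auto
  show "X c b a = X b a c" if "{a, b, c} \<subseteq> S" "distinct [a, b, c]"
    using rotate[of c b a] that by auto
  show "X a b c = (\<not> X b a c)" if "{a, b, c} \<subseteq> S" "distinct [a, b, c]"
    using swap[of b a c] that by auto
  show "X c b d" if S: "{a, b, c, d} \<subseteq> S" "distinct [a, b, c, d]" and "X b a c" "X c a d" "X d a b"
  proof -
    have "X a c b" "X a d c" "X a b d"
      using rot[of a b c] rot[of a c d] rot[of a d b] that by force+
    then have "X d c b" using interior[of a d c b] S by force
    then show ?thesis using rotate[of d c b] S by force
  qed
  show "\<not> (X b a e \<and> X c a e \<and> X d a e) \<and> \<not> (X e a b \<and> X e a c \<and> X e a d)"
    if S: "{a, b, c, d, e} \<subseteq> S" "distinct [a, b, c, d, e]" and "X b a c" "X c a d" "X d a b"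
  proof -
    have "X a c b" "X a d c" "X a b d"
      using rot[of a b c] rot[of a c d] rot[of a d b] that by force+
    then have "\<not> (X a d e \<and> X a c e \<and> X a b e) \<and> \<not> (X a e d \<and> X a e c \<and> X a e b)"
      using pencil[of a d c b e] S by force
    moreover have "X b a e = X a e b" "X c a e = X a e c" "X d a e = X a e d"
      "X e a b = X a b e" "X e a c = X a c e" "X e a d = X a d e"
      using S by (intro rot; force)+
    ultimately show ?thesis by blast
  qed
qed

section \<open>Parity along an odd closed walk\<close>

lemma odd_cycle_has_equal_neighbours:
  fixes f :: "nat \<Rightarrow> bool"
  assumes "odd n"
  shows "\<exists>j<n. f (Suc j mod n) = f j"
proof (rule ccontr)
  assume "\<not> ?thesis"
  then have flip: "f (Suc j mod n) = (\<not> f j)" if "j < n" for j using that by auto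
  have alt: "f j = (f 0 = even j)" if "j < n" for j
    using that
  proof (induction j)
    case (Suc j)
    then show ?case using flip[of j] by auto
  qed simp
  have "0 < n" using assms by (cases n) auto
  then show False
    using flip[of "n - 1"] alt[of "n - 1"] assms by (auto simp: Suc_diff_1)
qed

text \<open>
  Two crossing lines \<open>v a\<close> and \<open>v b\<close> cut the plane into four sectors: the wedge between the rays
  \<open>v a\<close> and \<open>v b\<close>, the opposite wedge, and two side sectors.  Here \<open>w'\<close> lies in the opposite wedge.
  The Grassmann-Pluecker relation forces a line \<open>w w'\<close> that has \<open>a\<close> and \<open>b\<close> on one side and \<open>v\<close> on
  the other to have \<open>w'\<close> beyond the line \<open>a b\<close>, where the opposite wedge is not.
\<close>

lemma no_transversal_through_opposite_wedge:
  assumes "ccw v a b" "\<not> ccw v a w'" "ccw v b w'"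
    and "ccw w w' v \<noteq> ccw w w' a" "ccw w w' v \<noteq> ccw w w' b"
    and "orient v a w' \<noteq> 0" "orient w w' v \<noteq> 0" "orient w w' a \<noteq> 0" "orient w w' b \<noteq> 0"
  shows False
proof -
  define s where "s = (if ccw w w' v then 1 else - 1 :: real)"
  have sv: "0 < s * orient w w' v" and sa: "s * orient w w' a < 0" and sb: "s * orient w w' b < 0"
    using assms by (auto simp: s_def)
  have "orient w w' v * orient w' a b = orient w w' a * orient v b w' - orient w w' b * orient v a w'"
    by (simp add: orient_def algebra_simps)
  then have gp: "(s * orient w w' v) * orient w' a b =
      (s * orient w w' a) * orient v b w' - (s * orient w w' b) * orient v a w'"
    by (metis mult.assoc right_diff_distrib)
  have neg: "orient v a w' < 0" using assms by auto
  have "(s * orient w w' a) * orient v b w' < 0" using sa assms by (simp add: mult_neg_pos)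
  moreover have "0 < (s * orient w w' b) * orient v a w'" using sb neg by (simp add: mult_neg_neg)
  ultimately have "(s * orient w w' v) * orient w' a b < 0" using gp by linarith
  then have "orient w' a b < 0"
    using mult_less_0_iff[of "s * orient w w' v"] sv by simp
  moreover have "orient v a b = orient w' a b + orient v a w' - orient v b w'"
    by (simp add: orient_def algebra_simps)
  ultimately show False using assms neg by linarith
qed

text \<open>
  A segment that meets both arms of the corner at \<open>v\<close> crosses both lines.  If it started in the wedge
  or in its opposite, it would run from one to the other, but its line avoids the opposite wedge; so
  it runs from one side sector to the other.
\<close>

lemma transversal_ends_in_side_sectors:
  assumes n: "orient v a w \<noteq> 0" "orient v b w \<noteq> 0" "orient v a w' \<noteq> 0" "orient v b w' \<noteq> 0"
    and nz': "orient w w' v \<noteq> 0" "orient w w' a \<noteq> 0" "orient w w' b \<noteq> 0" "orient v a b \<noteq> 0"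
    and cr: "crosses ccw v a w w'" "crosses ccw v b w w'"
  shows "(ccw v a w = ccw v a b) \<noteq> (ccw v b w = ccw v b a)"
proof
  assume eq: "(ccw v a w = ccw v a b) = (ccw v b w = ccw v b a)"
  have opp: "ccw v b a = (\<not> ccw v a b)"
    using nz'(4) orient_swap[of v b a] orient_rotate[of v a b] orient_rotate[of b v a] by auto
  note cr' = cr[unfolded crosses_def]
  have sw: "orient w' w x = - orient w w' x" for x by (rule orient_swap)
  have crw: "ccw w' w v \<noteq> ccw w' w a" "ccw w' w v \<noteq> ccw w' w b"
    using cr' sw nz' by auto
  consider "ccw v a b" "ccw v a w" | "ccw v a b" "\<not> ccw v a w" | "\<not> ccw v a b" "ccw v b w" | "\<not> ccw v a b" "\<not> ccw v b w"
    by blast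
  then show False
  proof cases
    case 1
    then have "ccw v a b" "\<not> ccw v a w'" "ccw v b w'"
      using eq opp cr' by blast+
    moreover have "ccw w w' v \<noteq> ccw w w' a" "ccw w w' v \<noteq> ccw w w' b"
      using cr' crw by blast+
    ultimately show False
      by (rule no_transversal_through_opposite_wedge) (use n nz' sw in auto)
  next
    case 2
    then have "ccw v a b" "\<not> ccw v a w" "ccw v b w"
      using eq opp cr' by blast+
    moreover have "ccw w' w v \<noteq> ccw w' w a" "ccw w' w v \<noteq> ccw w' w b"
      using cr' crw by blast+
    ultimately show False
      by (rule no_transversal_through_opposite_wedge) (use n nz' sw in auto)
  next
    case 3
    then have "ccw v b a" "\<not> ccw v b w'" "ccw v a w'"
      using eq opp cr' by blast+
    moreover have "ccw w w' v \<noteq> ccw w w' b" "ccw w w' v \<noteq> ccw w w' a"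
      using cr' crw by blast+
    ultimately show False
      by (rule no_transversal_through_opposite_wedge) (use n nz' sw in auto)
  next
    case 4
    then have "ccw v b a" "\<not> ccw v b w" "ccw v a w"
      using eq opp cr' by blast+
    moreover have "ccw w' w v \<noteq> ccw w' w b" "ccw w' w v \<noteq> ccw w' w a"
      using cr' crw by blast+
    ultimately show False
      by (rule no_transversal_through_opposite_wedge) (use n nz' sw in auto)
  qed
qed

text \<open>
  Along each side of the closed walk, crossing \<open>v a\<close> flips the predicate \<open>p\<close> (being on the side of \<open>b\<close>
  of the line \<open>v a\<close>), and crossing \<open>v b\<close> flips \<open>q\<close> (being on the side of \<open>a\<close> of the line \<open>v b\<close>).  At
  the ends of a side that crosses both, \<open>p\<close> and the negation of \<open>q\<close> agree.  If no side that misses \<open>v a\<close>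
  were adjacent to one that misses \<open>v b\<close>, one could record \<open>p\<close> at the vertices next to a side that
  misses \<open>v b\<close> and the negation of \<open>q\<close> elsewhere, and the record would flip along every side of an odd
  cycle.
\<close>

lemma hooked_corner:
  assumes "odd n"
    and nz: "\<And>j. j < n \<Longrightarrow> orient v a (w j) \<noteq> 0 \<and> orient v b (w j) \<noteq> 0"
    and nz': "\<And>j. j < n \<Longrightarrow> orient (w j) (w (Suc j mod n)) v \<noteq> 0 \<and> orient (w j) (w (Suc j mod n)) a \<noteq> 0
        \<and> orient (w j) (w (Suc j mod n)) b \<noteq> 0"
    and vab: "orient v a b \<noteq> 0"
    and cross: "\<And>j. j < n \<Longrightarrow> crosses ccw v a (w j) (w (Suc j mod n)) \<or> crosses ccw v b (w j) (w (Suc j mod n))"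
  shows "\<exists>j<n. let k = Suc j mod n; l = Suc k mod n in
     \<not> crosses ccw v a (w j) (w k) \<and> \<not> crosses ccw v b (w k) (w l) \<or>
     \<not> crosses ccw v b (w j) (w k) \<and> \<not> crosses ccw v a (w k) (w l)"
proof (rule ccontr)
  assume no_hook: "\<not> ?thesis"
  define A where "A j = crosses ccw v a (w j) (w (Suc j mod n))" for j
  define B where "B j = crosses ccw v b (w j) (w (Suc j mod n))" for j
  define p where "p j = (ccw v a (w j) = ccw v a b)" for j
  define q where "q j = (ccw v b (w j) = ccw v b a)" for j
  have n: "0 < n" using assms(1) by (cases n) auto
  have AB: "A j \<or> B j" if "j < n" for j using cross that by (simp add: A_def B_def)
  have seq: "(A j \<or> B (Suc j mod n)) \<and> (B j \<or> A (Suc j mod n))" if "j < n" for j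
    using no_hook that by (auto simp: A_def B_def Let_def)
  have flip_p: "p (Suc j mod n) = (\<not> p j)" if "A j" for j
    using that by (auto simp: A_def p_def crosses_def)
  have flip_q: "q (Suc j mod n) = (\<not> q j)" if "B j" for j
    using that by (auto simp: B_def q_def crosses_def)
  have aside: "p j = (\<not> q j)" if "j < n" "A j" "B j" for j
  proof -
    have k: "Suc j mod n < n" using n by simp
    have "(ccw v a (w j) = ccw v a b) \<noteq> (ccw v b (w j) = ccw v b a)"
    proof (rule transversal_ends_in_side_sectors)
      show "orient v a (w j) \<noteq> 0" "orient v b (w j) \<noteq> 0"
        "orient v a (w (Suc j mod n)) \<noteq> 0" "orient v b (w (Suc j mod n)) \<noteq> 0"
        using nz that(1) k by blast+
      show "orient (w j) (w (Suc j mod n)) v \<noteq> 0" "orient (w j) (w (Suc j mod n)) a \<noteq> 0"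
        "orient (w j) (w (Suc j mod n)) b \<noteq> 0" using nz' that(1) by blast+
    qed (use that vab in \<open>simp_all add: A_def B_def\<close>)
    then show ?thesis by (simp add: p_def q_def)
  qed
  define prev where "prev j = (if j = 0 then n - 1 else j - 1)" for j
  have prev: "prev j < n" "Suc (prev j) mod n = j" if "j < n" for j
    using that n by (auto simp: prev_def)
  have prev_Suc: "prev (Suc j mod n) = j" if "j < n" for j
  proof (cases "Suc j = n")
    case False
    then show ?thesis using that by (simp add: prev_def)
  qed (simp add: prev_def)
  \<comment> \<open>A side that crosses both arms may end next to a side that misses \<open>v b\<close>; there both records agree.\<close>
  define g where "g j = (if B j \<and> B (prev j) then \<not> q j else p j)" for j
  have "g (Suc j mod n) = (\<not> g j)" if j: "j < n" for j
  proof -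
    define k where "k = Suc j mod n"
    have k: "k < n" "prev k = j" using n j prev_Suc by (simp_all add: k_def)
    have c: "(A (prev j) \<or> B j) \<and> (B (prev j) \<or> A j)" "(A j \<or> B k) \<and> (B j \<or> A k)"
      using seq[OF prev(1)[OF j]] prev(2)[OF j] seq[OF j] by (simp_all add: k_def)
    have fp: "A j \<Longrightarrow> p k = (\<not> p j)" and fq: "B j \<Longrightarrow> q k = (\<not> q j)"
      using flip_p flip_q by (simp_all add: k_def)
    consider "A j" "B j" | "\<not> A j" "B j" | "A j" "\<not> B j" using AB[OF j] by blast
    then show ?thesis
    proof cases
      case 1
      then have "p j = (\<not> q j)" using aside j by blast
      then show ?thesis using 1 fp fq k by (auto simp: g_def k_def[symmetric])
    next
      case 2
      then have "B (prev j)" "B k" using c by blast+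
      then show ?thesis using 2 fq k by (auto simp: g_def k_def[symmetric])
    next
      case 3
      then show ?thesis using fp k by (auto simp: g_def k_def[symmetric])
    qed
  qed
  then show False using odd_cycle_has_equal_neighbours[OF assms(1), of g] by blast
qed

section \<open>Three homogeneous hooks are impossible\<close>

text \<open>
  The corners of three hooks are numbered: hook \<open>i\<close> has the corners \<open>6 * i\<close> (the vertex \<open>v\<close> between \<open>a\<close>
  and \<open>b\<close>), \<open>6 * i + 1\<close> and \<open>6 * i + 2\<close> (the other ends of \<open>a\<close> and of \<open>b\<close>), \<open>6 * i + 3\<close> (the vertex
  \<open>u\<close> between \<open>c\<close> and \<open>d\<close>), \<open>6 * i + 4\<close> and \<open>6 * i + 5\<close> (the other ends of \<open>c\<close> and of \<open>d\<close>).  The last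
  component tells whether sorting is an even permutation.
\<close>

definition sort_triple :: "int \<Rightarrow> int \<Rightarrow> int \<Rightarrow> int \<times> int \<times> int \<times> bool" where
  "sort_triple a b c =
    (if a < b then if b < c then (a, b, c, True) else if a < c then (a, c, b, False) else (c, a, b, True)
     else if a < c then (b, a, c, False) else if b < c then (b, c, a, True) else (c, b, a, False))"

text \<open>
  Homogeneity says that a triple from at most two hooks has the same orientation as the corresponding
  triple in hooks 0 and 1, and that a triple inside one hook has the same orientation as in hook 0.
\<close>

definition base_triple :: "int \<Rightarrow> int \<Rightarrow> int \<Rightarrow> int \<times> int \<times> int" where
  "base_triple a b c =
    (let i = a div 6; j = b div 6; k = c div 6 in
      if i = k then (a mod 6, b mod 6, c mod 6)
      else if i = j then (a mod 6, b mod 6, 6 + c mod 6)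
      else if j = k then (a mod 6, 6 + b mod 6, 6 + c mod 6)
      else (a, b, c))"

type_synonym signed_triple = "int \<times> int \<times> int \<times> bool"

definition literal :: "int \<Rightarrow> int \<Rightarrow> int \<Rightarrow> signed_triple" where
  "literal a b c = (case sort_triple a b c of (a, b, c, s) \<Rightarrow>
    case base_triple a b c of (p, q, r) \<Rightarrow> (p, q, r, s))"

fun negate :: "signed_triple \<Rightarrow> signed_triple" where
  "negate (a, b, c, s) = (a, b, c, \<not> s)"

fun literal_true :: "(int \<Rightarrow> int \<Rightarrow> int \<Rightarrow> bool) \<Rightarrow> signed_triple \<Rightarrow> bool" where
  "literal_true X (a, b, c, True) = X a b c"
| "literal_true X (a, b, c, False) = (\<not> X a b c)"

primrec clause_true :: "(int \<Rightarrow> int \<Rightarrow> int \<Rightarrow> bool) \<Rightarrow> signed_triple list \<Rightarrow> bool" where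
  "clause_true X [] = False"
| "clause_true X (l # ls) = (literal_true X l \<or> clause_true X ls)"

primrec all_true :: "(int \<Rightarrow> int \<Rightarrow> int \<Rightarrow> bool) \<Rightarrow> signed_triple list list \<Rightarrow> bool" where
  "all_true X [] = True"
| "all_true X (c # cs) = (clause_true X c \<and> all_true X cs)"

fun interior_clause :: "int \<times> int \<times> int \<times> int \<Rightarrow> signed_triple list" where
  "interior_clause (a, b, c, d) =
    [negate (literal a b c), negate (literal a c d), negate (literal a d b), literal b c d]"

text \<open>
  The Boolean selects the side of the line through \<open>a\<close> and \<open>e\<close> on which the three corners cannot all lie.
\<close>

fun pencil_clause :: "bool \<Rightarrow> int \<times> int \<times> int \<times> int \<times> int \<Rightarrow> signed_triple list" where
  "pencil_clause out (a, b, c, d, e) =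
    [negate (literal a b c), negate (literal a c d), negate (literal a d b)] @
    (if out then [negate (literal a b e), negate (literal a c e), negate (literal a d e)]
     else [negate (literal a e b), negate (literal a e c), negate (literal a e d)])"

fun cross_clauses :: "int \<times> int \<times> int \<times> int \<Rightarrow> signed_triple list list" where
  "cross_clauses (p, q, r, s) =
    (let A = literal p q r; B = literal p q s; C = literal r s p; D = literal r s q in
      [[A, B], [negate A, negate B], [C, D], [negate C, negate D]])"

fun miss_clauses :: "int \<times> int \<times> int \<times> int \<Rightarrow> signed_triple list list" where
  "miss_clauses (p, q, r, s) =
    (let A = literal p q r; B = literal p q s; C = literal r s p; D = literal r s q in
      [[A, negate B, C, negate D], [A, negate B, negate C, D],
       [negate A, B, C, negate D], [negate A, B, negate C, D]])"

text \<open>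
  A quadruple \<open>(p, q, r, s)\<close> stands for the segments \<open>p q\<close> and \<open>r s\<close>.  By homogeneity it is enough to
  state the conditions for hooks 0 and 1.  Nothing is said about \<open>b\<close> in one hook and \<open>d\<close> in
  another: their labels may agree, as when one label recurs in all the hooks.
\<close>

definition missing :: "(int \<times> int \<times> int \<times> int) list" where
  "missing = [(0,1,6,7), (0,1,6,8), (0,2,6,7), (0,2,6,8), (3,4,9,10), (3,4,9,11), (3,5,9,10), (3,5,9,11),
     (0,1,3,4), (0,2,3,5)]"

definition crossing :: "(int \<times> int \<times> int \<times> int) list" where
  "crossing = [(0,1,9,10), (6,7,3,4), (0,1,9,11), (6,7,3,5), (0,1,3,5), (0,2,9,10), (6,8,3,4), (0,2,3,4)]"

text \<open>
  The instances of the rules \<open>interior\<close> and \<open>pencil\<close> that make up the refutation.  In every tuple the first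
  point is the one inside the triangle of the next three.
\<close>

definition interior_instances :: "(int \<times> int \<times> int \<times> int) list" where
  "interior_instances = [
  (0,1,2,9), (0,1,3,5), (0,1,3,9), (0,1,5,3), (0,1,9,10), (0,1,9,11), (0,1,11,9), (0,1,12,9),
  (0,2,3,4), (0,2,3,9), (0,2,4,3), (0,2,4,6), (0,2,4,9), (0,2,6,3), (0,2,9,10), (0,2,10,9),
  (0,3,4,6), (0,3,4,9), (0,3,5,4), (0,3,6,4), (0,3,6,5), (0,3,6,7), (0,3,6,9), (0,3,9,4),
  (0,3,9,6), (0,3,9,10), (0,3,9,12), (0,3,11,4), (0,3,11,9), (0,4,6,10), (0,6,7,13), (0,6,9,7),
  (0,6,10,9), (0,6,12,9), (0,6,15,10), (0,7,12,9), (0,8,12,9), (0,9,10,12), (0,9,11,12),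
  (1,3,7,9), (1,6,14,9), (1,6,17,9), (2,9,12,14), (3,4,6,7), (3,4,6,8), (3,4,6,9), (3,4,7,6),
  (3,4,8,12), (3,4,9,6), (3,5,6,7), (3,5,7,6), (3,6,7,15), (3,6,9,10), (3,7,11,9), (4,6,8,7),
  (4,9,13,12), (5,6,9,10)]"

definition outer_pencil_instances :: "(int \<times> int \<times> int \<times> int \<times> int) list" where
  "outer_pencil_instances = [
  (0,1,2,3,5), (0,1,2,3,9), (0,1,2,5,3), (0,1,2,6,3), (0,1,2,11,9), (0,1,3,6,9), (0,1,3,9,2),
  (0,1,3,10,9), (0,1,4,3,5), (0,1,4,5,3), (0,1,4,6,2), (0,1,4,8,9), (0,1,4,9,2), (0,1,4,10,9),
  (0,1,4,11,2), (0,1,6,5,3), (0,1,6,9,2), (0,1,6,10,2), (0,1,6,15,2), (0,1,7,10,6),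
  (0,1,7,15,13), (0,1,8,6,10), (0,1,9,5,3), (0,1,12,9,2), (0,1,12,11,9), (0,2,4,11,9),
  (0,2,6,4,3), (0,2,6,9,12), (0,2,6,10,9), (0,2,7,3,6), (0,2,9,3,4), (0,2,12,3,9), (0,3,4,6,9),
  (0,3,6,13,9), (0,3,7,15,2), (0,3,13,6,2), (0,3,15,6,2), (0,4,6,15,12), (0,6,12,15,3),
  (0,9,12,13,15), (1,0,3,9,11), (1,0,8,17,6), (1,2,11,9,4), (2,0,1,6,3), (2,0,3,10,9),
  (2,0,5,3,4), (2,0,5,6,1), (2,0,13,10,3), (3,0,2,6,5), (3,0,4,6,2), (3,0,5,6,1), (3,0,6,4,7),
  (3,0,6,4,8), (3,0,6,4,9), (3,0,6,5,2), (3,0,6,15,12), (3,0,7,4,6), (3,0,8,4,6), (3,0,9,4,6),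
  (3,0,9,6,4), (3,1,2,4,0), (3,1,5,2,0), (3,1,5,4,0), (3,1,5,6,0), (3,1,6,4,0), (3,1,6,9,0),
  (3,1,7,4,5), (3,1,9,4,0), (3,2,4,6,0), (3,2,4,7,0), (3,2,4,9,0), (3,2,4,10,0), (3,2,8,4,6),
  (3,2,10,4,6), (3,4,5,10,6), (3,4,9,7,6), (3,4,9,8,6), (3,4,9,12,0), (3,4,9,14,0), (3,4,10,6,0),
  (3,4,10,7,9), (3,4,10,12,0), (3,4,12,9,0), (3,4,15,6,0), (3,4,15,6,7), (3,4,15,8,6),
  (3,4,16,6,0), (3,5,9,6,0), (3,8,17,14,0), (3,9,12,15,8), (4,0,1,3,6), (4,0,3,9,2),
  (4,0,5,3,10), (4,0,6,3,8), (4,0,7,3,6), (4,1,3,10,9), (4,1,3,11,9), (4,3,6,9,12),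
  (4,3,7,12,15), (4,3,9,8,6), (4,6,9,12,0), (4,6,9,15,14), (5,0,3,10,6), (5,2,6,3,7),
  (5,3,4,6,0), (5,3,9,6,10), (5,3,9,12,4), (6,0,1,9,3), (6,0,3,7,8), (6,0,3,8,4), (6,0,4,7,3),
  (6,0,7,10,3), (6,0,7,10,8), (6,0,9,8,10), (6,0,9,16,3), (6,0,15,12,9), (6,1,4,7,0),
  (6,2,5,7,3), (6,2,7,10,3), (6,2,15,8,3), (6,3,7,9,8), (6,3,7,10,8), (6,3,8,9,4), (6,3,9,7,12),
  (6,3,13,8,0), (6,4,7,9,8), (6,4,7,10,8), (6,5,7,8,3), (6,5,7,9,8), (6,5,7,10,8), (6,7,8,9,3),
  (6,8,14,15,3), (7,3,6,9,4), (7,3,6,9,5), (7,4,6,9,3), (7,6,9,10,3), (8,0,1,9,6), (8,0,15,6,3),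
  (8,3,6,11,9), (8,3,6,14,12), (9,0,3,12,6), (9,0,4,6,3), (9,0,5,6,12), (9,0,6,11,12),
  (9,0,10,1,2), (9,0,10,3,1), (9,0,10,4,3), (9,0,10,6,2), (9,0,10,6,12), (9,0,10,8,11),
  (9,0,10,12,6), (9,0,10,15,12), (9,0,12,6,11), (9,0,12,10,15), (9,0,14,10,12), (9,1,10,3,0),
  (9,1,10,3,7), (9,1,10,4,0), (9,1,10,6,0), (9,1,10,7,11), (9,1,11,4,0), (9,2,10,11,0),
  (9,2,10,15,0), (9,3,4,6,0), (9,3,6,11,0), (9,3,8,10,6), (9,3,10,7,6), (9,3,11,6,0),
  (9,3,12,10,6), (9,3,12,15,6), (9,3,14,10,2), (9,4,8,10,6), (9,4,8,11,3), (9,4,14,10,6),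
  (9,6,13,12,0), (10,0,9,6,2), (10,0,9,15,12), (10,1,9,6,0), (10,1,14,9,12), (10,2,9,5,3),
  (10,3,6,9,12), (10,3,13,9,2), (10,6,7,9,0), (10,6,9,15,0), (12,0,3,9,13), (12,0,11,15,3),
  (12,0,13,9,3), (12,0,13,15,9), (12,1,9,3,0), (12,1,10,13,0), (12,3,6,13,9), (12,3,9,6,15),
  (12,4,14,16,9), (12,7,15,9,3), (12,7,15,14,0), (12,7,15,14,4), (13,0,3,10,6), (14,1,12,15,10),
  (15,0,3,17,6), (15,0,7,16,6), (15,0,8,16,6), (15,0,16,9,8), (15,0,16,10,12), (15,3,6,9,17),
  (15,3,7,16,0), (15,3,8,16,17), (15,4,6,16,12), (15,4,7,16,0), (15,7,17,14,0), (16,3,6,15,2),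
  (17,3,15,8,1)]"

definition inner_pencil_instances :: "(int \<times> int \<times> int \<times> int \<times> int) list" where
  "inner_pencil_instances = [
  (0,1,2,3,4), (0,1,2,3,9), (0,1,2,4,3), (0,1,2,4,6), (0,1,2,7,6), (0,1,2,14,9), (0,1,3,6,5),
  (0,1,4,3,11), (0,1,4,6,10), (0,1,4,7,6), (0,1,9,3,10), (0,1,10,13,15), (0,1,10,15,9),
  (0,1,17,9,3), (0,2,4,6,3), (0,2,4,6,8), (0,2,4,9,3), (0,2,6,3,9), (0,2,8,3,9), (0,2,9,3,1),
  (0,2,9,4,1), (0,2,9,6,3), (0,2,9,8,3), (0,2,9,12,3), (0,2,10,3,9), (0,2,10,5,1), (0,2,10,6,9),
  (0,2,10,12,9), (0,2,15,6,3), (0,2,16,7,3), (0,3,6,4,1), (0,3,6,7,13), (0,3,7,6,9), (0,3,7,9,6),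
  (0,3,8,9,6), (0,3,9,6,4), (0,3,9,7,1), (0,3,9,11,12), (0,3,9,12,6), (0,3,12,8,1), (0,4,9,6,10),
  (0,6,9,15,3), (0,7,9,15,6), (0,8,9,15,6), (0,9,12,15,3), (1,0,3,2,5), (1,0,9,2,11),
  (1,0,9,4,10), (1,0,10,4,9), (2,0,5,7,6), (2,1,3,9,0), (2,3,6,15,0), (3,0,1,6,4), (3,0,2,6,8),
  (3,0,5,4,6), (3,0,5,6,7), (3,0,5,7,6), (3,0,6,4,2), (3,0,6,9,4), (3,0,6,15,4), (3,0,9,1,4),
  (3,0,9,4,2), (3,0,9,4,6), (3,0,10,4,9), (3,0,12,9,4), (3,0,15,8,6), (3,1,2,5,0), (3,1,4,2,0),
  (3,1,6,5,0), (3,1,11,4,9), (3,2,5,4,0), (3,2,5,6,0), (3,2,5,7,6), (3,2,6,4,0), (3,4,6,9,7),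
  (3,4,7,9,6), (3,4,7,16,15), (3,4,8,11,9), (3,4,9,6,0), (3,4,9,12,6), (3,4,12,9,0),
  (3,4,14,6,12), (3,5,7,9,6), (3,6,9,12,4), (3,6,12,9,0), (3,6,12,15,4), (3,7,12,9,11),
  (4,0,1,3,6), (4,0,3,8,6), (4,0,5,3,9), (4,0,9,3,12), (4,0,9,12,3), (4,0,10,3,6), (4,0,10,6,9),
  (4,1,3,2,0), (4,1,3,9,0), (4,3,6,8,7), (4,3,7,9,6), (4,3,12,9,13), (4,3,15,7,0), (5,2,4,10,3),
  (6,0,7,3,4), (6,0,7,4,3), (6,0,7,8,3), (6,0,7,9,3), (6,0,8,3,7), (6,0,8,4,3), (6,0,8,15,9),
  (6,0,9,3,8), (6,0,9,8,7), (6,0,10,8,7), (6,0,10,9,7), (6,0,11,8,7), (6,1,7,10,0), (6,1,8,4,3),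
  (6,1,14,7,12), (6,2,7,5,3), (6,2,7,9,0), (6,2,7,16,0), (6,3,9,5,0), (6,3,9,8,4), (6,3,9,8,7),
  (6,3,9,8,12), (6,3,10,8,7), (6,3,10,9,12), (6,3,10,12,15), (6,3,12,8,15), (6,4,5,10,3),
  (6,4,9,8,3), (6,4,10,8,7), (6,4,11,8,7), (6,4,14,7,16), (6,7,8,9,3), (6,7,8,9,4), (6,7,8,9,5),
  (6,7,9,15,3), (7,2,6,5,3), (7,6,12,13,0), (8,0,9,6,12), (8,3,9,12,0), (8,4,9,6,3),
  (8,6,11,9,3), (9,0,3,10,1), (9,0,3,10,2), (9,0,3,11,1), (9,0,4,15,2), (9,0,6,10,11),
  (9,0,6,11,8), (9,0,6,11,12), (9,0,8,12,10), (9,0,10,6,12), (9,0,10,13,12), (9,0,11,12,6),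
  (9,0,12,3,6), (9,0,12,10,1), (9,0,12,10,3), (9,0,13,11,6), (9,0,15,12,10), (9,1,3,10,0),
  (9,1,3,11,0), (9,1,6,11,0), (9,1,8,11,10), (9,1,10,14,12), (9,1,12,10,0), (9,2,12,3,0),
  (9,3,6,15,10), (9,3,7,6,10), (9,3,7,10,0), (9,3,8,11,6), (9,3,10,6,0), (9,3,12,11,0),
  (9,4,6,12,3), (9,4,6,16,10), (9,4,10,6,12), (9,4,10,7,3), (9,4,11,6,3), (9,5,10,7,3),
  (9,6,11,12,1), (9,6,12,10,0), (10,0,8,15,9), (10,0,9,6,12), (10,0,9,8,12), (10,1,15,9,0),
  (10,3,5,9,0), (11,0,6,9,4), (11,1,3,9,0), (12,0,3,9,1), (12,0,3,9,13), (12,0,3,9,15),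
  (12,0,3,14,9), (12,0,9,1,13), (12,0,9,3,13), (12,0,9,3,15), (12,0,9,6,3), (12,0,9,6,13),
  (12,0,9,14,3), (12,0,9,15,3), (12,0,13,9,6), (12,0,13,10,9), (12,0,14,10,13), (12,1,9,6,10),
  (12,3,8,13,4), (12,3,8,14,13), (12,3,9,6,13), (12,3,13,6,9), (12,4,9,14,0), (12,4,13,9,0),
  (15,0,12,10,1), (15,0,12,17,7), (15,3,14,12,6), (15,4,9,13,0), (15,4,12,7,16), (15,4,12,9,16),
  (16,3,15,7,0), (16,4,15,6,9), (17,1,9,15,0)]"

definition clauses :: "signed_triple list list" where
  "clauses = map interior_clause interior_instances @ map (pencil_clause True) outer_pencil_instances
     @ map (pencil_clause False) inner_pencil_instances
     @ concat (map cross_clauses crossing) @ concat (map miss_clauses missing)"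

text \<open>
  Evaluation turns every triple into its normal form, so that the orientations of triples with the same
  normal form become the same propositional atom.  The resulting formula is refuted by resolution; the
  premise fixes one of the two mirror images.
\<close>

lemma clauses_contradictory: "X 0 1 2 \<Longrightarrow> \<not> all_true X clauses"
  apply code_simp
  apply (simp only: all_true.simps clause_true.simps literal_true.simps)
  by sat

lemma clause_true_iff: "clause_true X ls \<longleftrightarrow> (\<exists>l\<in>set ls. literal_true X l)"
  by (induction ls) auto

lemma all_true_iff: "all_true X cs \<longleftrightarrow> (\<forall>c\<in>set cs. clause_true X c)"
  by (induction cs) auto

lemma literal_true_negate [simp]: "literal_true X (negate l) = (\<not> literal_true X l)"
  by (cases "(X, l)" rule: literal_true.cases) auto

definition points_ok :: "int list \<Rightarrow> bool" where
  "points_ok xs \<longleftrightarrow> distinct xs \<and> list_all (\<lambda>x. 0 \<le> x \<and> x < 18) xs"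

lemma literal_true_literal:
  assumes "chirotope {0..<18} X"
    and hom: "\<And>a b c. \<lbrakk>0 \<le> a; a < b; b < c; c < 18\<rbrakk> \<Longrightarrow> X a b c = (case base_triple a b c of (p, q, r) \<Rightarrow> X p q r)"
    and ok: "points_ok [a, b, c]"
  shows "literal_true X (literal a b c) = X a b c"
proof -
  interpret chirotope "{0..<18}" X by fact
  obtain p q r s where pqrs: "sort_triple a b c = (p, q, r, s)" by (metis prod_cases4)
  have sorted: "0 \<le> p \<and> p < q \<and> q < r \<and> r < 18"
    using pqrs ok by (auto simp: sort_triple_def points_ok_def split: if_splits)
  have X: "X p q r = (X a b c = s)"
    using pqrs ok rotate[of a b c] rotate[of b c a] swap[of a b c] rotate[of b a c] rotate[of a c b]
    by (auto simp: sort_triple_def points_ok_def split: if_splits)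
  obtain x y z where xyz: "base_triple p q r = (x, y, z)" by (metis prod_cases3)
  have "X p q r = X x y z" using hom[of p q r] sorted xyz by simp
  moreover have "literal_true X (x, y, z, s) = (X x y z = s)" by (cases s) auto
  ultimately show ?thesis using X by (auto simp: literal_def pqrs xyz)
qed

lemma all_true_clauses:
  assumes ch: "chirotope {0..<18} X"
    and hom: "\<And>a b c. \<lbrakk>0 \<le> a; a < b; b < c; c < 18\<rbrakk> \<Longrightarrow> X a b c = (case base_triple a b c of (p, q, r) \<Rightarrow> X p q r)"
    and cross: "\<And>p q r s. (p, q, r, s) \<in> set crossing \<Longrightarrow> crosses X p q r s"
    and miss: "\<And>p q r s. (p, q, r, s) \<in> set missing \<Longrightarrow> \<not> crosses X p q r s"
  shows "all_true X clauses"
proof -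
  interpret chirotope "{0..<18}" X by fact
  note lit = literal_true_literal[OF ch hom]
  have "clause_true X (interior_clause t)" if t: "t \<in> set interior_instances" for t
  proof -
    obtain a b c d where abcd: "t = (a, b, c, d)" by (metis prod_cases4)
    have "list_all (\<lambda>(a, b, c, d). points_ok [a, b, c, d]) interior_instances" by code_simp
    then have "points_ok [a, b, c, d]" using t abcd by (auto simp: list_all_iff)
    then show ?thesis
      using interior[of a b c d] by (auto simp: clause_true_iff abcd lit points_ok_def)
  qed
  moreover have "clause_true X (pencil_clause out t)"
    if t: "t \<in> set outer_pencil_instances \<union> set inner_pencil_instances" for t out
  proof -
    obtain a b c d e where abcde: "t = (a, b, c, d, e)" by (metis prod_cases5)
    have "list_all (\<lambda>(a, b, c, d, e). points_ok [a, b, c, d, e]) (outer_pencil_instances @ inner_pencil_instances)"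
      by code_simp
    then have "\<forall>x\<in>set outer_pencil_instances \<union> set inner_pencil_instances.
        case x of (a, b, c, d, e) \<Rightarrow> points_ok [a, b, c, d, e]" by (simp only: list_all_iff set_append)
    from bspec[OF this t] have "points_ok [a, b, c, d, e]" by (simp add: abcde)
    then show ?thesis
      using pencil[of a b c d e] by (auto simp: clause_true_iff abcde lit points_ok_def)
  qed
  moreover have "clause_true X cl" if "t \<in> set crossing" "cl \<in> set (cross_clauses t)" for t cl
  proof -
    obtain p q r s where t: "t = (p, q, r, s)" by (metis prod_cases4)
    have "list_all (\<lambda>(p, q, r, s). points_ok [p, q, r, s]) crossing" by code_simp
    then have "points_ok [p, q, r, s]" using that t by (auto simp: list_all_iff)
    then show ?thesis
      using cross[of p q r s] that by (auto simp: clause_true_iff t lit points_ok_def crosses_def Let_def)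
  qed
  moreover have "clause_true X cl" if "t \<in> set missing" "cl \<in> set (miss_clauses t)" for t cl
  proof -
    obtain p q r s where t: "t = (p, q, r, s)" by (metis prod_cases4)
    have "list_all (\<lambda>(p, q, r, s). points_ok [p, q, r, s]) missing" by code_simp
    then have "points_ok [p, q, r, s]" using that t by (auto simp: list_all_iff)
    then show ?thesis
      using miss[of p q r s] that by (auto simp: clause_true_iff t lit points_ok_def crosses_def Let_def)
  qed
  ultimately show ?thesis
    by (simp only: all_true_iff clauses_def set_append set_map set_concat) blast
qed

lemma base_triple_ok:
  assumes abc: "0 \<le> a" "a < b" "b < c" "c < 18" and pqr: "base_triple a b c = (p, q, r)"
  shows "points_ok [p, q, r]"
proof -
  have mod: "x mod 6 < y mod 6" if "x < y" "x div 6 = y div 6" for x y :: int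
    using that by presburger
  have "a div 6 = b div 6 \<and> b div 6 = c div 6" if "a div 6 = c div 6"
    using abc that zdiv_mono1[of a b 6] zdiv_mono1[of b c 6] by simp
  then consider "a div 6 = c div 6" "a mod 6 < b mod 6" "b mod 6 < c mod 6"
    | "a div 6 \<noteq> c div 6" "a div 6 = b div 6" "a mod 6 < b mod 6"
    | "a div 6 \<noteq> c div 6" "a div 6 \<noteq> b div 6" "b div 6 = c div 6" "b mod 6 < c mod 6"
    | "a div 6 \<noteq> c div 6" "a div 6 \<noteq> b div 6" "b div 6 \<noteq> c div 6"
    using mod abc by blast
  then show ?thesis
  proof cases
    case 1
    then have "p = a mod 6" "q = b mod 6" "r = c mod 6" using pqr by (simp_all add: base_triple_def)
    with 1(2,3) have "0 \<le> p" "p < q" "q < r" "r < 6" by simp_all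
    then show ?thesis by (simp add: points_ok_def)
  next
    case 2
    then have "p = a mod 6" "q = b mod 6" "r = 6 + c mod 6" using pqr by (simp_all add: base_triple_def)
    with 2(3) have "0 \<le> p" "p < q" "q < 6" "6 \<le> r" "r < 12" by simp_all
    then show ?thesis by (simp add: points_ok_def)
  next
    case 3
    then have "p = a mod 6" "q = 6 + b mod 6" "r = 6 + c mod 6" using pqr by (simp_all add: base_triple_def)
    with 3(4) have "0 \<le> p" "p < 6" "6 \<le> q" "q < r" "r < 12" by simp_all
    then show ?thesis by (simp add: points_ok_def)
  next
    case 4
    then have "p = a" "q = b" "r = c" using pqr by (simp_all add: base_triple_def)
    then show ?thesis using abc by (simp add: points_ok_def)
  qed
qed

text \<open>
  Reflection reduces the case of a clockwise triangle \<open>0 1 2\<close> to the counterclockwise one, since it turns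
  an orientation into an orientation and keeps crossings.
\<close>

theorem no_homogeneous_hooked_triple:
  assumes ch: "chirotope {0..<18} X"
    and hom: "\<And>a b c. \<lbrakk>0 \<le> a; a < b; b < c; c < 18\<rbrakk> \<Longrightarrow> X a b c = (case base_triple a b c of (p, q, r) \<Rightarrow> X p q r)"
    and cross: "\<And>p q r s. (p, q, r, s) \<in> set crossing \<Longrightarrow> crosses X p q r s"
    and miss: "\<And>p q r s. (p, q, r, s) \<in> set missing \<Longrightarrow> \<not> crosses X p q r s"
  shows False
proof (cases "X 0 1 2")
  case True
  then show False using clauses_contradictory all_true_clauses[OF assms] by blast
next
  case False
  interpret chirotope "{0..<18}" X by fact
  define Y where "Y a b c = X b a c" for a b c
  have Y: "Y a b c = (\<not> X a b c)" if "points_ok [a, b, c]" for a b c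
    using swap[of a b c] that by (auto simp: Y_def points_ok_def)
  have crosses: "crosses Y p q r s = crosses X p q r s" if "points_ok [p, q, r, s]" for p q r s
    using that Y[of p q r] Y[of p q s] Y[of r s p] Y[of r s q] by (auto simp: crosses_def points_ok_def)
  have chY: "chirotope {0..<18} Y" using chirotope_reflect by (simp add: Y_def[abs_def])
  have homY: "Y a b c = (case base_triple a b c of (p, q, r) \<Rightarrow> Y p q r)"
    if "0 \<le> a" "a < b" "b < c" "c < 18" for a b c
  proof -
    obtain p q r where pqr: "base_triple a b c = (p, q, r)" by (metis prod_cases3)
    have "points_ok [p, q, r]" using base_triple_ok[OF that pqr] .
    then show ?thesis
      using hom[OF that] Y[of p q r] Y[of a b c] that by (simp add: pqr points_ok_def)
  qed
  have list_ok: "list_all (\<lambda>(p, q, r, s). points_ok [p, q, r, s]) (crossing @ missing)" by code_simp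
  have ok: "points_ok [p, q, r, s]" if "(p, q, r, s) \<in> set (crossing @ missing)" for p q r s
    using bspec[OF list_ok[unfolded list_all_iff] that] by simp
  have crossY: "crosses Y p q r s" if "(p, q, r, s) \<in> set crossing" for p q r s
    using crosses[OF ok] cross that by simp
  have missY: "\<not> crosses Y p q r s" if "(p, q, r, s) \<in> set missing" for p q r s
    using crosses[OF ok] miss that by simp
  have "all_true Y clauses" using all_true_clauses[OF chY homY crossY missY] .
  moreover have "Y 0 1 2" using False Y[of 0 1 2] by (simp add: points_ok_def)
  ultimately show False using clauses_contradictory by blast
qed

section \<open>Few labels, Ramsey and windows in a cycle\<close>

text \<open>
  The labelling plays the part of the connected components: inserting an edge identifies the labels of
  its ends, which destroys at most one label.
\<close>

lemma labelling_with_few_edges: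
  assumes "finite E" "finite V" "E \<subseteq> V \<times> V"
  shows "\<exists>f :: 'a \<Rightarrow> 'a. (\<forall>(x, y)\<in>E. f x = f y) \<and> card V \<le> card E + card (f ` V)"
  using assms(1,3)
proof (induction E rule: finite_induct)
  case empty
  then show ?case by (intro exI[of _ id]) simp
next
  case (insert e E)
  obtain x y where e: "e = (x, y)" by (cases e)
  from insert obtain f :: "'a \<Rightarrow> 'a" where f: "\<forall>(x, y)\<in>E. f x = f y" "card V \<le> card E + card (f ` V)" by auto
  define g where "g z = (if f z = f y then f x else f z)" for z
  have "f ` V - {f y} \<subseteq> g ` V" by (auto simp: g_def)
  then have "card (f ` V - {f y}) \<le> card (g ` V)" using assms(2) by (intro card_mono) auto
  moreover have "card (f ` V) \<le> Suc (card (f ` V - {f y}))"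
    by (cases "f y \<in> f ` V") (simp_all add: card_Diff_singleton_if)
  ultimately have "card (f ` V) \<le> Suc (card (g ` V))" by linarith
  then have "card V \<le> card (insert e E) + card (g ` V)" using f(2) insert by simp
  moreover have "\<forall>(x, y)\<in>insert e E. g x = g y" using f(1) by (auto simp: g_def e)
  ultimately show ?case by blast
qed

text \<open>
  The colour of a pair may depend on which element is the smaller one.
\<close>

lemma ramsey_ordered_pairs:
  fixes T :: "'c set"
  assumes "finite T"
  shows "\<exists>N. \<forall>col :: nat \<Rightarrow> nat \<Rightarrow> 'c. (\<forall>x y. col x y \<in> T) \<longrightarrow>
    (\<exists>H c. H \<subseteq> {..<N} \<and> card H = k \<and> (\<forall>x\<in>H. \<forall>y\<in>H. x < y \<longrightarrow> col x y = c))"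
proof -
  obtain h where h: "bij_betw h T {..<card T}" using ex_bij_betw_finite_nat[OF assms] atLeast0LessThan by metis
  obtain N :: nat where N: "partn_lst {..<N} (replicate (card T) k) 2" using ramsey_full[of "replicate (card T) k" 2] by blast
  have "\<exists>H c. H \<subseteq> {..<N} \<and> card H = k \<and> (\<forall>x\<in>H. \<forall>y\<in>H. x < y \<longrightarrow> col x y = c)"
    if col: "\<And>x y. col x y \<in> T" for col :: "nat \<Rightarrow> nat \<Rightarrow> 'c"
  proof -
    have hc: "(\<lambda>X. h (col (Min X) (Max X))) \<in> nsets {..<N} 2 \<rightarrow> {..<card T}"
      using h col by (auto simp: bij_betw_def)
    obtain i H where i: "i < length (replicate (card T) k)"
      and H: "H \<in> nsets {..<N} (replicate (card T) k ! i)" "(\<lambda>X. h (col (Min X) (Max X))) ` nsets H 2 \<subseteq> {i}"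
      by (rule partn_lstE[OF N hc length_replicate])
    have "h (col x y) = i" if "x \<in> H" "y \<in> H" "x < y" for x y
    proof -
      have "{x, y} \<in> nsets H 2" using that by simp
      then have "h (col (Min {x, y}) (Max {x, y})) = i" using H(2) by blast
      then show ?thesis using that by simp
    qed
    then have "col x y = inv_into T h i" if "x \<in> H" "y \<in> H" "x < y" for x y
      using that h col by (metis bij_betw_inv_into_left)
    moreover have "H \<subseteq> {..<N}" "card H = k" using H(1) i by (auto simp: nsets_def)
    ultimately show ?thesis by blast
  qed
  then show ?thesis by blast
qed

lemma three_increasing_elements:
  fixes H :: "nat set"
  assumes "3 \<le> card H"
  obtains x y z where "x \<in> H" "y \<in> H" "z \<in> H" "x < y" "y < z"
proof -
  let ?l = "sorted_list_of_set H"
  have fin: "finite H" using assms by (auto intro: card_ge_0_finite)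
  have "sorted_wrt (<) ?l" by simp
  then have "?l ! 0 < ?l ! 1" "?l ! 1 < ?l ! 2"
    using assms sorted_wrt_nth_less[of "(<)" ?l] by force+
  moreover have "?l ! i \<in> H" if "i < 3" for i
    using that assms fin nth_mem[of i ?l] by simp
  ultimately show thesis using that[of "?l ! 0" "?l ! 1" "?l ! 2"] by simp
qed

lemma add_mod_left_cancel:
  fixes a b r n :: nat
  assumes "(a + r) mod n = (b + r) mod n" "a < n" "b < n"
  shows "a = b"
proof -
  define s where "s = n - r mod n"
  have "r mod n < n" using assms(2) by simp
  then have rs: "r + s = n * (r div n) + n"
    using mult_div_mod_eq[of n r] unfolding s_def by linarith
  have "x mod n = ((x + r) mod n + s) mod n" for x
    using rs by (metis add.assoc mod_add_left_eq mod_add_self2 mod_mult_self2)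
  then have "a mod n = b mod n" using assms(1) by metis
  then show ?thesis using assms(2,3) by simp
qed

text \<open>
  Windows of three consecutive places in a cycle: a window can touch a given one in at most nine
  positions.  The Boolean allows two elements to start their windows at the same place.
\<close>

lemma window_degree:
  fixes f :: "'a \<Rightarrow> nat" and b :: "'a \<Rightarrow> bool"
  assumes inj: "inj_on (\<lambda>x. (f x, b x)) H" and lt: "\<And>x. x \<in> H \<Longrightarrow> f x < n"
    and meet: "\<And>x. x \<in> H \<Longrightarrow> \<exists>r<3. \<exists>s<3. (f x + r) mod n = (w + s) mod n"
  shows "card H \<le> 18"
proof -
  obtain r s where rs: "\<And>x. x \<in> H \<Longrightarrow> r x < 3 \<and> s x < 3 \<and> (f x + r x) mod n = (w + s x) mod n"
    using meet by metis
  have "inj_on (\<lambda>x. (r x, s x, b x)) H"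
  proof (rule inj_onI)
    fix x y assume xy: "x \<in> H" "y \<in> H" and eq: "(r x, s x, b x) = (r y, s y, b y)"
    then have "(f x + r x) mod n = (f y + r x) mod n" using rs[of x] rs[of y] by simp
    then have "f x = f y" using add_mod_left_cancel lt xy by blast
    then show "x = y" using inj xy eq by (auto dest: inj_onD)
  qed
  moreover have "(\<lambda>x. (r x, s x, b x)) ` H \<subseteq> {..<3} \<times> {..<3} \<times> UNIV" using rs by auto
  ultimately have "card H \<le> card ({..<3::nat} \<times> {..<3::nat} \<times> (UNIV :: bool set))"
    by (intro card_inj_on_le[where f = "\<lambda>x. (r x, s x, b x)"]) auto
  then show ?thesis by (simp add: card_cartesian_product)
qed

section \<open>Hooks between two odd simple polygons\<close>

lemma Suc_mod_neq: "i < k \<Longrightarrow> 2 \<le> k \<Longrightarrow> Suc i mod k \<noteq> i" for i k :: nat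
  by (cases "Suc i = k") auto

lemma sides_disjoint:
  assumes "simple_polygon L" "i < length L" "j < length L" "i \<noteq> j"
    "j \<noteq> Suc i mod length L" "i \<noteq> Suc j mod length L"
  shows "side L i \<inter> side L j = {}"
  using assms by (simp add: simple_polygon_def)

lemma inj_on_side:
  assumes "simple_polygon L"
  shows "inj_on (side L) {..<length L}"
proof (rule inj_onI, rule ccontr)
  fix i j assume ij: "i \<in> {..<length L}" "j \<in> {..<length L}" "side L i = side L j" "i \<noteq> j"
  have L: "3 \<le> length L" "distinct L" using assms by (auto simp: simple_polygon_def)
  have "Suc i mod length L < length L" using L by (intro mod_less_divisor) linarith
  moreover have "Suc i mod length L \<noteq> i"
    using ij L by (cases "Suc i = length L") auto
  ultimately have neq: "L ! i \<noteq> next_vertex L i" using ij L by (simp add: next_vertex_def nth_eq_iff_index_eq)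
  have "side L i \<inter> side L j = {L ! j} \<or> side L i \<inter> side L j = {L ! i} \<or> side L i \<inter> side L j = {}"
    using assms ij(1,2,4) by (auto simp: simple_polygon_def)
  then obtain x where x: "side L i \<subseteq> {x}" using ij(3) by auto
  have "L ! i \<in> side L i" "next_vertex L i \<in> side L i" by (simp_all add: side_def)
  then have "L ! i = x" "next_vertex L i = x" using x by (blast dest: subsetD)+
  then show False using neq by simp
qed

text \<open>
  A hook occupies three consecutive vertices of each polygon, at offsets 0, 1, 2 from its first one; the
  middle one is the vertex \<open>v\<close> or \<open>u\<close>.  The Boolean tells whether the side named first (\<open>a\<close> or \<open>c\<close>)
  precedes the other one along the polygon.
\<close>

definition offset :: "bool \<Rightarrow> nat \<Rightarrow> nat" where
  "offset b t = (if t = 0 then 1 else if (t = 1) = b then 0 else 2)"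

lemma offset_less: "offset b t < 3"
  by (simp add: offset_def)

lemma offset_inj: "s < 3 \<Longrightarrow> t < 3 \<Longrightarrow> offset b s = offset b t \<Longrightarrow> s = t"
  by (auto simp: offset_def split: if_splits)

locale odd_polygon_pair =
  fixes P Q :: "(real^2) list"
  assumes simple_P: "simple_polygon P" and simple_Q: "simple_polygon Q"
    and general: "general_position P Q"
    and odd_P: "odd (length P)" and odd_Q: "odd (length Q)"
begin

lemma length_ge_3: "3 \<le> length P" "3 \<le> length Q"
  using simple_P simple_Q by (auto simp: simple_polygon_def)

lemma next_vertex_in: "i < length P \<Longrightarrow> next_vertex P i \<in> set P" "j < length Q \<Longrightarrow> next_vertex Q j \<in> set Q"
  using length_ge_3 by (auto simp: next_vertex_def intro!: nth_mem mod_less_divisor)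

lemma distinct_vertices: "distinct P" "distinct Q" "set P \<inter> set Q = {}"
  using general by (auto simp: general_position_def)

lemma orient_nonzero:
  "{a, b, c} \<subseteq> set P \<union> set Q \<Longrightarrow> distinct [a, b, c] \<Longrightarrow> orient a b c \<noteq> 0"
  using general unfolding orient_eq_0_iff_collinear general_position_def by auto

lemma next_vertex_neq: "i < length P \<Longrightarrow> P ! i \<noteq> next_vertex P i" "j < length Q \<Longrightarrow> Q ! j \<noteq> next_vertex Q j"
proof -
  have *: "L ! i \<noteq> next_vertex L i" if "i < length L" "distinct L" "3 \<le> length L" for L :: "(real^2) list" and i
  proof -
    have "Suc i mod length L < length L" using that by (intro mod_less_divisor) linarith
    then show ?thesis
      using that Suc_mod_neq[of i "length L"] by (auto simp: next_vertex_def nth_eq_iff_index_eq)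
  qed
  show "i < length P \<Longrightarrow> P ! i \<noteq> next_vertex P i" "j < length Q \<Longrightarrow> Q ! j \<noteq> next_vertex Q j"
    using * distinct_vertices length_ge_3 by blast+
qed

lemma meet_iff_crosses:
  assumes "p \<in> set P" "p' \<in> set P" "p \<noteq> p'" "q \<in> set Q" "q' \<in> set Q" "q \<noteq> q'"
  shows "closed_segment p p' \<inter> closed_segment q q' \<noteq> {} \<longleftrightarrow> crosses ccw p p' q q'"
proof (rule segments_meet_iff_crosses)
  have "distinct [p, p', q]" "distinct [p, p', q']" "distinct [q, q', p]" "distinct [q, q', p']"
    using assms distinct_vertices(3) by auto
  then show "orient p p' q \<noteq> 0" "orient p p' q' \<noteq> 0" "orient q q' p \<noteq> 0" "orient q q' p' \<noteq> 0"
    using assms orient_nonzero[of p p' q] orient_nonzero[of p p' q'] orient_nonzero[of q q' p]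
      orient_nonzero[of q q' p'] by auto
qed

lemma sides_meet_iff_crosses:
  assumes "i < length P" "j < length Q"
  shows "side P i \<inter> side Q j \<noteq> {} \<longleftrightarrow> crosses ccw (P ! i) (next_vertex P i) (Q ! j) (next_vertex Q j)"
  unfolding side_def using assms next_vertex_in next_vertex_neq by (intro meet_iff_crosses) auto

text \<open>
  The roles of the polygons are symmetric except for the order of the list of side vectors.
\<close>

lemma odd_polygon_pair_swap: "odd_polygon_pair Q P"
proof
  show "general_position Q P"
  proof -
    let ?D = "side_vectors P @ side_vectors Q" and ?D' = "side_vectors Q @ side_vectors P"
    define k l where "k = length (side_vectors P)" and "l = length (side_vectors Q)"
    define t where "t i = (if i < l then i + k else i - l)" for i
    have par: "\<not> collinear {0, ?D ! i, ?D ! j}" if "i < k + l" "j < k + l" "i \<noteq> j" for i j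
      using general that by (auto simp: general_position_def Let_def k_def l_def)
    have t: "t i < k + l" "?D' ! i = ?D ! t i" if "i < k + l" for i
      using that by (auto simp: t_def nth_append k_def l_def)
    have inj: "t i \<noteq> t j" if "i < k + l" "j < k + l" "i \<noteq> j" for i j
      using that by (auto simp: t_def split: if_splits)
    have "\<forall>i<length ?D'. \<forall>j<length ?D'. i \<noteq> j \<longrightarrow> \<not> collinear {0, ?D' ! i, ?D' ! j}"
      using par t inj by (simp add: k_def l_def add.commute)
    moreover have "distinct (Q @ P)" "set (Q @ P) = set (P @ Q)" using distinct_vertices by auto
    ultimately show ?thesis using general unfolding general_position_def Let_def by metis
  qed
qed (use simple_P simple_Q odd_P odd_Q in auto)

text \<open>
  Otherwise the vertices of \<open>Q\<close> alternate between the two sides of a line.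
\<close>

lemma ex_disjoint_side:
  assumes i: "i < length P"
  shows "\<exists>j<length Q. side P i \<inter> side Q j = {}"
proof (rule ccontr)
  assume "\<not> ?thesis"
  then have "crosses ccw (P ! i) (next_vertex P i) (Q ! j) (Q ! (Suc j mod length Q))" if "j < length Q" for j
    using sides_meet_iff_crosses[OF i that] that by (auto simp: next_vertex_def)
  then have "ccw (P ! i) (next_vertex P i) (Q ! (Suc j mod length Q)) \<noteq> ccw (P ! i) (next_vertex P i) (Q ! j)"
    if "j < length Q" for j
    using that by (auto simp: crosses_def)
  then show False
    using odd_cycle_has_equal_neighbours[OF odd_Q, of "\<lambda>j. ccw (P ! i) (next_vertex P i) (Q ! j)"] by blast
qed

lemma hooked_corner_of_Q:
  assumes i: "i < length P"
  defines "i' \<equiv> Suc i mod length P"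
  assumes meet: "\<And>j. j < length Q \<Longrightarrow> side P i \<inter> side Q j \<noteq> {} \<or> side P i' \<inter> side Q j \<noteq> {}"
  shows "\<exists>j<length Q. let k = Suc j mod length Q in
    side P i \<inter> side Q j = {} \<and> side P i' \<inter> side Q k = {} \<or> side P i' \<inter> side Q j = {} \<and> side P i \<inter> side Q k = {}"
proof -
  let ?n = "length Q"
  define v a b where "v = P ! i'" and "a = P ! i" and "b = next_vertex P i'"
  have i': "i' < length P" using length_ge_3 unfolding i'_def by (intro mod_less_divisor) linarith
  have Suc_i: "v = next_vertex P i" by (simp add: v_def next_vertex_def i'_def)
  have in_P: "v \<in> set P" "a \<in> set P" "b \<in> set P" "v \<noteq> a" "v \<noteq> b"
    using i i' next_vertex_in(1)[OF i] next_vertex_in(1)[OF i'] next_vertex_neq(1)[OF i] next_vertex_neq(1)[OF i'] Suc_i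
    by (auto simp: v_def a_def b_def)
  have "Suc i' mod length P \<noteq> i"
  proof -
    have "Suc i' mod length P = (i + 2) mod length P" unfolding i'_def by (simp add: mod_Suc_eq)
    also have "\<dots> \<noteq> i" using i length_ge_3(1) by (cases "i + 2 < length P") (auto simp: mod_if)
    finally show ?thesis .
  qed
  moreover have "Suc i' mod length P < length P" using length_ge_3 by (intro mod_less_divisor) linarith
  ultimately have "a \<noteq> b"
    using distinct_vertices(1) i by (auto simp: a_def b_def next_vertex_def nth_eq_iff_index_eq)
  have Q: "Q ! j \<in> set Q" "Q ! (Suc j mod ?n) \<in> set Q" "Q ! j \<noteq> Q ! (Suc j mod ?n)" if "j < ?n" for j
    using that next_vertex_in(2)[OF that] next_vertex_neq(2)[OF that] by (auto simp: next_vertex_def)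
  have sa: "side P i \<inter> side Q j \<noteq> {} \<longleftrightarrow> crosses ccw v a (Q ! j) (Q ! (Suc j mod ?n))" if "j < ?n" for j
    using meet_iff_crosses[of v a "Q ! j" "Q ! (Suc j mod ?n)"] in_P Q[OF that]
    by (simp add: side_def next_vertex_def[of Q] Suc_i[symmetric] a_def[symmetric] closed_segment_commute)
  have sb: "side P i' \<inter> side Q j \<noteq> {} \<longleftrightarrow> crosses ccw v b (Q ! j) (Q ! (Suc j mod ?n))" if "j < ?n" for j
    using meet_iff_crosses[of v b "Q ! j" "Q ! (Suc j mod ?n)"] in_P Q[OF that]
    by (simp add: side_def next_vertex_def[of Q] v_def[symmetric] b_def[symmetric])
  have "\<exists>j<?n. let k = Suc j mod ?n; l = Suc k mod ?n in
     \<not> crosses ccw v a (Q ! j) (Q ! k) \<and> \<not> crosses ccw v b (Q ! k) (Q ! l) \<or>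
     \<not> crosses ccw v b (Q ! j) (Q ! k) \<and> \<not> crosses ccw v a (Q ! k) (Q ! l)"
  proof (rule hooked_corner[OF odd_Q])
    fix j assume j: "j < ?n"
    have ne: "x \<noteq> y" "y \<noteq> x" if "x \<in> set P" "y \<in> set Q" for x y
      using that distinct_vertices(3) by auto
    note Qj = Q[OF j]
    show "orient v a (Q ! j) \<noteq> 0 \<and> orient v b (Q ! j) \<noteq> 0"
      using Qj in_P by (intro conjI orient_nonzero) (auto simp: ne)
    show "orient (Q ! j) (Q ! (Suc j mod ?n)) v \<noteq> 0 \<and> orient (Q ! j) (Q ! (Suc j mod ?n)) a \<noteq> 0
      \<and> orient (Q ! j) (Q ! (Suc j mod ?n)) b \<noteq> 0"
      using Qj in_P by (intro conjI orient_nonzero) (auto simp: ne)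
    show "crosses ccw v a (Q ! j) (Q ! (Suc j mod ?n)) \<or> crosses ccw v b (Q ! j) (Q ! (Suc j mod ?n))"
      using meet[OF j] sa[OF j] sb[OF j] by blast
  next
    show "orient v a b \<noteq> 0" using in_P \<open>a \<noteq> b\<close> by (intro orient_nonzero) auto
  qed
  then obtain j where j: "j < ?n" and h: "let k = Suc j mod ?n; l = Suc k mod ?n in
     \<not> crosses ccw v a (Q ! j) (Q ! k) \<and> \<not> crosses ccw v b (Q ! k) (Q ! l) \<or>
     \<not> crosses ccw v b (Q ! j) (Q ! k) \<and> \<not> crosses ccw v a (Q ! k) (Q ! l)" by blast
  have k: "Suc j mod ?n < ?n" using j by (intro mod_less_divisor) linarith
  show ?thesis
    using h j sa[OF j] sb[OF j] sa[OF k] sb[OF k] unfolding Let_def by blast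
qed

text \<open>
  The six corners of the hook formed by the sides \<open>i\<close>, \<open>Suc i\<close> of \<open>P\<close> and \<open>j\<close>, \<open>Suc j\<close> of \<open>Q\<close>, in the
  numbering of the finite argument.
\<close>

definition corner :: "nat \<Rightarrow> nat \<Rightarrow> bool \<Rightarrow> nat \<Rightarrow> real^2" where
  "corner i j b t =
    (if t < 3 then P ! ((i + offset True t) mod length P) else Q ! ((j + offset b (t - 3)) mod length Q))"

lemma corner_sides:
  assumes "i < length P" "j < length Q"
  shows "closed_segment (corner i j b 0) (corner i j b 1) = side P i"
    and "closed_segment (corner i j b 0) (corner i j b 2) = side P (Suc i mod length P)"
    and "closed_segment (corner i j b 3) (corner i j b 4) = side Q (if b then j else Suc j mod length Q)"
    and "closed_segment (corner i j b 3) (corner i j b 5) = side Q (if b then Suc j mod length Q else j)"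
  using assms
  by (auto simp: corner_def offset_def side_def next_vertex_def mod_Suc_eq closed_segment_commute)

text \<open>
  Three hooks of the polygons that share no vertices and are homogeneous satisfy the hypotheses of the
  finite argument: in general position, meeting is the same as crossing, and sides of a simple polygon
  without a common vertex are disjoint.
\<close>

lemma no_homogeneous_hooks:
  fixes I J :: "nat \<Rightarrow> nat" and B :: "nat \<Rightarrow> bool"
  defines "K \<equiv> \<lambda>x. corner (I x) (J x) (B x)"
    and "c \<equiv> \<lambda>x. if B x then J x else Suc (J x) mod length Q"
    and "d \<equiv> \<lambda>x. if B x then Suc (J x) mod length Q else J x"
  assumes I: "\<And>x. x < 3 \<Longrightarrow> I x < length P" and J: "\<And>x. x < 3 \<Longrightarrow> J x < length Q"
    and apart_P: "\<And>x y r s. \<lbrakk>x < 3; y < 3; x \<noteq> y; r < 3; s < 3\<rbrakk> \<Longrightarrow> (I x + r) mod length P \<noteq> (I y + s) mod length P"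
    and apart_Q: "\<And>x y r s. \<lbrakk>x < 3; y < 3; x \<noteq> y; r < 3; s < 3\<rbrakk> \<Longrightarrow> (J x + r) mod length Q \<noteq> (J y + s) mod length Q"
    and miss: "\<And>x. x < 3 \<Longrightarrow> side P (I x) \<inter> side Q (c x) = {} \<and> side P (Suc (I x) mod length P) \<inter> side Q (d x) = {}"
    and meet_ac: "\<And>x y. \<lbrakk>x < 3; y < 3; x \<noteq> y\<rbrakk> \<Longrightarrow> side P (I x) \<inter> side Q (c y) \<noteq> {}"
    and meet_ad: "\<And>x y. \<lbrakk>x < 3; y < 3\<rbrakk> \<Longrightarrow> side P (I x) \<inter> side Q (d y) \<noteq> {}"
    and meet_bc: "\<And>x y. \<lbrakk>x < 3; y < 3\<rbrakk> \<Longrightarrow> side P (Suc (I x) mod length P) \<inter> side Q (c y) \<noteq> {}"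
    and hom: "\<And>x y s t u e f g. \<lbrakk>x < y; y < 3; s < 6; t < 6; u < 6\<rbrakk> \<Longrightarrow>
      ccw (K (if e then y else x) s) (K (if f then y else x) t) (K (if g then y else x) u) =
      ccw (K (if e then 1 else 0) s) (K (if f then 1 else 0) t) (K (if g then 1 else 0) u)"
  shows False
proof -
  let ?m = "length P" and ?n = "length Q"
  have K_in: "t < 3 \<Longrightarrow> K x t \<in> set P" "\<not> t < 3 \<Longrightarrow> K x t \<in> set Q" for x t
    using length_ge_3 by (auto simp: K_def corner_def intro!: nth_mem mod_less_divisor)
  have K_inj: "x = y \<and> s = t" if eq: "K x s = K y t" and lt: "x < 3" "y < 3" "s < 6" "t < 6" for x y s t
  proof -
    have shift: "r = r'" if "(i + r) mod k = (i + r') mod k" "r < 3" "r' < 3" "3 \<le> k" for i r r' k :: nat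
      using that add_mod_left_cancel[of r i k r'] by (simp add: add.commute)
    consider "s < 3" "t < 3" | "\<not> s < 3" "\<not> t < 3" | "(s < 3) \<noteq> (t < 3)" by blast
    then show ?thesis
    proof cases
      case 1
      then have "P ! ((I x + offset True s) mod ?m) = P ! ((I y + offset True t) mod ?m)"
        using eq by (simp add: K_def corner_def)
      moreover have "a mod ?m < ?m" for a using length_ge_3 by (intro mod_less_divisor) linarith
      ultimately have eq': "(I x + offset True s) mod ?m = (I y + offset True t) mod ?m"
        using distinct_vertices(1) by (simp add: nth_eq_iff_index_eq)
      then have "x = y" using apart_P lt offset_less by blast
      then show ?thesis using shift[of "I x" "offset True s" ?m "offset True t"] eq' length_ge_3 offset_less offset_inj 1
        by blast
    next
      case 2
      then have "Q ! ((J x + offset (B x) (s - 3)) mod ?n) = Q ! ((J y + offset (B y) (t - 3)) mod ?n)"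
        using eq by (simp add: K_def corner_def)
      moreover have "a mod ?n < ?n" for a using length_ge_3 by (intro mod_less_divisor) linarith
      ultimately have eq': "(J x + offset (B x) (s - 3)) mod ?n = (J y + offset (B y) (t - 3)) mod ?n"
        using distinct_vertices(2) by (simp add: nth_eq_iff_index_eq)
      then have xy: "x = y" using apart_Q lt offset_less by blast
      then have "offset (B x) (s - 3) = offset (B x) (t - 3)"
        using shift[of "J x" "offset (B x) (s - 3)" ?n "offset (B x) (t - 3)"] eq' length_ge_3 offset_less by blast
      then have "s - 3 = t - 3" using offset_inj[of "s - 3" "t - 3" "B x"] lt by simp
      then show ?thesis using xy 2 by simp
    next
      case 3
      then have False using K_in[of s x] K_in[of t y] eq distinct_vertices(3) by auto
      then show ?thesis ..
    qed
  qed
  have K_orient: "orient (K x s) (K y t) (K z u) \<noteq> 0"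
    if "distinct [(x, s), (y, t), (z, u)]" "x < 3" "y < 3" "z < 3" "s < 6" "t < 6" "u < 6" for x y z s t u
  proof (rule orient_nonzero)
    show "{K x s, K y t, K z u} \<subseteq> set P \<union> set Q" using K_in by blast
    show "distinct [K x s, K y t, K z u]"
      using that K_inj[of x s y t] K_inj[of x s z u] K_inj[of y t z u] by auto
  qed
  have K_cross: "closed_segment (K x s) (K x t) \<inter> closed_segment (K y u) (K y v) \<noteq> {} \<longleftrightarrow>
      crosses ccw (K x s) (K x t) (K y u) (K y v)"
    if "distinct [(x, s), (x, t), (y, u), (y, v)]" "x < 3" "y < 3" "s < 6" "t < 6" "u < 6" "v < 6" for x y s t u v
    using that by (intro segments_meet_iff_crosses K_orient) auto
  have segs: "closed_segment (K x 0) (K x 1) = side P (I x)" "closed_segment (K x 0) (K x 2) = side P (Suc (I x) mod ?m)"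
    "closed_segment (K x 3) (K x 4) = side Q (c x)" "closed_segment (K x 3) (K x 5) = side Q (d x)" if "x < 3" for x
    using corner_sides[OF I[OF that] J[OF that]] by (simp_all add: K_def c_def d_def)
  have consecutive_disjoint: "side L ((i + r) mod length L) \<inter> side L ((j + s) mod length L) = {}"
    if L: "simple_polygon L"
      and apart: "\<And>r s. r < 3 \<Longrightarrow> s < 3 \<Longrightarrow> (i + r) mod length L \<noteq> (j + s) mod length L" and rs: "r < 2" "s < 2"
    for L :: "(real^2) list" and i j r s
  proof (rule sides_disjoint[OF L])
    have "0 < length L" using L by (auto simp: simple_polygon_def)
    then show "(i + r) mod length L < length L" "(j + s) mod length L < length L" by simp_all
    show "(i + r) mod length L \<noteq> (j + s) mod length L" using apart rs by simp
    show "(j + s) mod length L \<noteq> Suc ((i + r) mod length L) mod length L"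
      using apart[of "Suc r" s] rs by (simp add: mod_Suc_eq)
    show "(i + r) mod length L \<noteq> Suc ((j + s) mod length L) mod length L"
      using apart[of r "Suc s"] rs by (simp add: mod_Suc_eq)
  qed
  have disj_P: "side P ((I 0 + r) mod ?m) \<inter> side P ((I 1 + s) mod ?m) = {}" if "r < 2" "s < 2" for r s
    using consecutive_disjoint[OF simple_P] apart_P[of 0 1] that by simp
  have disj_Q: "side Q ((J 0 + r) mod ?n) \<inter> side Q ((J 1 + s) mod ?n) = {}" if "r < 2" "s < 2" for r s
    using consecutive_disjoint[OF simple_Q] apart_Q[of 0 1] that by simp
  have I01: "I 0 mod ?m = I 0" "I 1 mod ?m = I 1" and J01: "J 0 mod ?n = J 0" "J 1 mod ?n = J 1"
    using I J by simp_all
  have VV: "side P (I 0) \<inter> side P (I 1) = {}" "side P (I 0) \<inter> side P (Suc (I 1) mod ?m) = {}"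
      "side P (Suc (I 0) mod ?m) \<inter> side P (I 1) = {}" "side P (Suc (I 0) mod ?m) \<inter> side P (Suc (I 1) mod ?m) = {}"
    using disj_P[of 0 0] disj_P[of 0 1] disj_P[of 1 0] disj_P[of 1 1] I01 by simp_all
  have UU: "side Q (c 0) \<inter> side Q (c 1) = {}" "side Q (c 0) \<inter> side Q (d 1) = {}"
      "side Q (d 0) \<inter> side Q (c 1) = {}" "side Q (d 0) \<inter> side Q (d 1) = {}"
    using disj_Q[of 0 0] disj_Q[of 0 1] disj_Q[of 1 0] disj_Q[of 1 1] J01 by (simp_all add: c_def d_def)

  define pt where "pt a = K (nat (a div 6)) (nat (a mod 6))" for a :: int
  define X where "X a b c = ccw (pt a) (pt b) (pt c)" for a b c
  have pt: "pt 0 = K 0 0" "pt 1 = K 0 1" "pt 2 = K 0 2" "pt 3 = K 0 3" "pt 4 = K 0 4" "pt 5 = K 0 5"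
    "pt 6 = K 1 0" "pt 7 = K 1 1" "pt 8 = K 1 2" "pt 9 = K 1 3" "pt 10 = K 1 4" "pt 11 = K 1 5"
    by (simp_all add: pt_def)
  have ranges: "nat (a div 6) < 3" "nat (a mod 6) < 6" if "0 \<le> a" "a < 18" for a :: int
    using that by (simp_all add: nat_less_iff)
  have crosses_X: "crosses X p q r s \<longleftrightarrow> crosses ccw (pt p) (pt q) (pt r) (pt s)" for p q r s
    by (simp add: crosses_def X_def)
  have ac: "crosses ccw (K x 0) (K x 1) (K y 3) (K y 4)" if "x < 3" "y < 3" "x \<noteq> y" for x y
    using K_cross[of x 0 1 y 3 4] meet_ac[of x y] segs[OF that(1)] segs[OF that(2)] that by (simp del: One_nat_def)
  have ad: "crosses ccw (K x 0) (K x 1) (K y 3) (K y 5)" if "x < 3" "y < 3" for x y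
    using K_cross[of x 0 1 y 3 5] meet_ad[of x y] segs[OF that(1)] segs[OF that(2)] that by (simp del: One_nat_def)
  have bc: "crosses ccw (K x 0) (K x 2) (K y 3) (K y 4)" if "x < 3" "y < 3" for x y
    using K_cross[of x 0 2 y 3 4] meet_bc[of x y] segs[OF that(1)] segs[OF that(2)] that by (simp del: One_nat_def)
  have disjoint:
    "\<not> crosses ccw (K 0 0) (K 0 1) (K 1 0) (K 1 1)" "\<not> crosses ccw (K 0 0) (K 0 1) (K 1 0) (K 1 2)"
    "\<not> crosses ccw (K 0 0) (K 0 2) (K 1 0) (K 1 1)" "\<not> crosses ccw (K 0 0) (K 0 2) (K 1 0) (K 1 2)"
    "\<not> crosses ccw (K 0 3) (K 0 4) (K 1 3) (K 1 4)" "\<not> crosses ccw (K 0 3) (K 0 4) (K 1 3) (K 1 5)"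
    "\<not> crosses ccw (K 0 3) (K 0 5) (K 1 3) (K 1 4)" "\<not> crosses ccw (K 0 3) (K 0 5) (K 1 3) (K 1 5)"
    "\<not> crosses ccw (K 0 0) (K 0 1) (K 0 3) (K 0 4)" "\<not> crosses ccw (K 0 0) (K 0 2) (K 0 3) (K 0 5)"
    using K_cross[of 0 0 1 1 0 1] K_cross[of 0 0 1 1 0 2] K_cross[of 0 0 2 1 0 1] K_cross[of 0 0 2 1 0 2]
      K_cross[of 0 3 4 1 3 4] K_cross[of 0 3 4 1 3 5] K_cross[of 0 3 5 1 3 4] K_cross[of 0 3 5 1 3 5]
      K_cross[of 0 0 1 0 3 4] K_cross[of 0 0 2 0 3 5] VV UU miss[of 0] segs[of 0] segs[of 1] by (simp_all del: One_nat_def)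
  show False
  proof (rule no_homogeneous_hooked_triple[of X])
    show "chirotope {0..<18} X"
      unfolding X_def
    proof (rule chirotope_ccw)
      fix a b c :: int
      assume abc: "{a, b, c} \<subseteq> {0..<18}" "distinct [a, b, c]"
      have "(nat (a div 6), nat (a mod 6)) \<noteq> (nat (b div 6), nat (b mod 6))"
        if "0 \<le> a" "0 \<le> b" "a \<noteq> b" for a b :: int
      proof
        assume "(nat (a div 6), nat (a mod 6)) = (nat (b div 6), nat (b mod 6))"
        then have "a div 6 = b div 6" "a mod 6 = b mod 6"
          using that by (auto simp: nat_eq_iff2 pos_imp_zdiv_nonneg_iff)
        then show False using that by (metis mult_div_mod_eq)
      qed
      then show "orient (pt a) (pt b) (pt c) \<noteq> 0"
        unfolding pt_def using abc ranges by (intro K_orient) auto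
    qed
  next
    fix a b c :: int
    assume abc: "0 \<le> a" "a < b" "b < c" "c < 18"
    define i j k where "i = nat (a div 6)" and "j = nat (b div 6)" and "k = nat (c div 6)"
    define s t u where "s = nat (a mod 6)" and "t = nat (b mod 6)" and "u = nat (c mod 6)"
    have lt: "k < 3" "s < 6" "t < 6" "u < 6" using abc ranges by (auto simp: k_def s_def t_def u_def)
    have ij: "i \<le> j" "j \<le> k" using abc zdiv_mono1[of a b 6] zdiv_mono1[of b c 6]
      by (auto simp: i_def j_def k_def intro!: nat_mono)
    have eqs: "a div 6 = b div 6 \<longleftrightarrow> i = j" "b div 6 = c div 6 \<longleftrightarrow> j = k" "a div 6 = c div 6 \<longleftrightarrow> i = k"
      using abc by (auto simp: i_def j_def k_def nat_eq_iff2 pos_imp_zdiv_nonneg_iff)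
    have X_abc: "X a b c = ccw (K i s) (K j t) (K k u)"
      by (simp add: X_def pt_def i_def j_def k_def s_def t_def u_def)
    have low: "pt (a mod 6) = K 0 s" "pt (b mod 6) = K 0 t" "pt (c mod 6) = K 0 u"
      by (simp_all add: pt_def s_def t_def u_def)
    have "(6 + x mod 6) div 6 = 1" "(6 + x mod 6) mod 6 = x mod 6" for x :: int
      by (simp_all add: div_add_self1)
    then have high: "pt (6 + b mod 6) = K 1 t" "pt (6 + c mod 6) = K 1 u"
      by (simp_all add: pt_def t_def u_def)
    have single: "ccw (K x s) (K x t) (K x u) = ccw (K 0 s) (K 0 t) (K 0 u)" if "x < 3" for x
    proof -
      have "ccw (K 1 s) (K 1 t) (K 1 u) = ccw (K 0 s) (K 0 t) (K 0 u)"
        using hom[of 1 2 s t u False False False] lt by simp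
      moreover have "ccw (K 2 s) (K 2 t) (K 2 u) = ccw (K 1 s) (K 1 t) (K 1 u)"
        using hom[of 1 2 s t u True True True] lt by simp
      moreover have "x = 0 \<or> x = 1 \<or> x = 2" using that by auto
      ultimately show ?thesis by auto
    qed
    consider "i = k" "i = j" | "i < k" "i = j" | "i < k" "i \<noteq> j" "j = k" | "i \<noteq> k" "i \<noteq> j" "j \<noteq> k"
      using ij by linarith
    then show "X a b c = (case base_triple a b c of (p, q, r) \<Rightarrow> X p q r)"
    proof cases
      case 1
      then show ?thesis using single[of k] lt eqs by (simp add: base_triple_def X_abc X_def[of "_ mod 6"] low)
    next
      case 2
      then show ?thesis using hom[of i k s t u False False True] lt eqs
        by (simp add: base_triple_def X_abc X_def[of "_ mod 6"] low high)
    next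
      case 3
      then show ?thesis using hom[of i k s t u False True True] lt eqs
        by (simp add: base_triple_def X_abc X_def[of "_ mod 6"] low high)
    next
      case 4
      then show ?thesis using eqs by (simp add: base_triple_def)
    qed
  next
    fix p q r s
    assume "(p, q, r, s) \<in> set crossing"
    then show "crosses X p q r s" by (auto simp: crossing_def crosses_X pt ac ad bc simp del: One_nat_def)
  next
    fix p q r s
    assume "(p, q, r, s) \<in> set missing"
    then show "\<not> crosses X p q r s" by (auto simp: missing_def crosses_X pt disjoint simp del: One_nat_def)
  qed
qed

end

section \<open>Boundedly many labels\<close>

text \<open>
  A label that is not the only one is left at some place of the cyclic sequence.
\<close>

lemma last_index_with_label:
  fixes g :: "nat \<Rightarrow> 'b"
  assumes "\<kappa> \<in> g ` {..<m}" "2 \<le> card (g ` {..<m})"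
  obtains i where "i < m" "g i = \<kappa>" "g (Suc i mod m) \<noteq> \<kappa>"
proof -
  obtain k where k: "k < m" "g k = \<kappa>" using assms(1) by auto
  have "\<exists>i<m. g i = \<kappa> \<and> g (Suc i mod m) \<noteq> \<kappa>"
  proof (rule ccontr)
    assume "\<not> ?thesis"
    then have step: "g (Suc i mod m) = \<kappa>" if "i < m" "g i = \<kappa>" for i using that by blast
    have all: "g ((k + r) mod m) = \<kappa>" for r
    proof (induction r)
      case (Suc r)
      then show ?case using step[of "(k + r) mod m"] k by (simp add: mod_Suc_eq)
    qed (use k in simp)
    have "g i = \<kappa>" if "i < m" for i
      using all[of "i + m - k"] k that by simp
    then have "g ` {..<m} \<subseteq> {\<kappa>}" by auto
    then show False using assms(2) card_mono[of "{\<kappa>}" "g ` {..<m}"] by simp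
  qed
  then show thesis using that by blast
qed

text \<open>
  Each label \<open>\<kappa>\<close> has a hook whose sides \<open>a\<close> and \<open>c\<close> have the label \<open>\<kappa>\<close>; write \<open>\<sigma>\<close> for the label of \<open>b\<close>
  and \<open>d\<close>.  The colour of two hooks records the orientations of all triples of their corners, whether
  they touch in \<open>P\<close> or in \<open>Q\<close>, and whether the \<open>\<sigma>\<close> of one is the label of the other.  A homogeneous set
  of twenty hooks cannot touch pairwise, because at most eighteen others touch a given one; and \<open>\<sigma>\<close> of
  one hook cannot be two different labels, nor can two labels be the \<open>\<sigma>\<close> of one hook.  So homogeneity
  excludes both kinds of contact for all pairs, and any three of the hooks give the contradiction.
\<close>

lemma bounded_number_of_labels:
  "\<exists>N. \<forall>P Q. \<forall>g h :: nat \<Rightarrow> 'b. odd_polygon_pair P Q \<longrightarrow>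
    (\<forall>i<length P. \<forall>j<length Q. g i \<noteq> h j \<longrightarrow> side P i \<inter> side Q j \<noteq> {}) \<longrightarrow>
    card (g ` {..<length P}) \<le> N"
proof -
  define A :: "(nat \<times> bool) set" where "A = {..<6} \<times> UNIV"
  define T :: "(((nat \<times> bool) \<times> (nat \<times> bool) \<times> (nat \<times> bool)) set \<times> bool \<times> bool \<times> bool \<times> bool) set"
    where "T = Pow (A \<times> A \<times> A) \<times> UNIV"
  have "finite T" by (simp add: T_def A_def)
  from ramsey_ordered_pairs[OF this, of 20] obtain N :: nat where ramsey: "\<forall>col :: nat \<Rightarrow> nat \<Rightarrow> _. (\<forall>x y. col x y \<in> T)
    \<longrightarrow> (\<exists>H c. H \<subseteq> {..<N} \<and> card H = 20 \<and> (\<forall>x\<in>H. \<forall>y\<in>H. x < y \<longrightarrow> col x y = c))"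
    by (rule exE) (rule that)
  show ?thesis
  proof (intro exI[of _ "max N 1"] allI impI)
    fix P Q and g h :: "nat \<Rightarrow> 'b"
    assume "odd_polygon_pair P Q"
      and label: "\<forall>i<length P. \<forall>j<length Q. g i \<noteq> h j \<longrightarrow> side P i \<inter> side Q j \<noteq> {}"
    interpret odd_polygon_pair P Q by fact
    let ?m = "length P" and ?n = "length Q"
    define \<Lambda> where "\<Lambda> = g ` {..<?m}"
    show "card (g ` {..<?m}) \<le> max N 1"
    proof (rule ccontr)
      assume "\<not> ?thesis"
      then have many: "N < card \<Lambda>" "2 \<le> card \<Lambda>" by (auto simp: \<Lambda>_def)
      have Suc_less: "Suc i mod ?m < ?m" "Suc i mod ?n < ?n" for i
        using length_ge_3 by (auto intro!: mod_less_divisor)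
      have "\<exists>i j b. i < ?m \<and> j < ?n \<and> g i = \<kappa> \<and> g (Suc i mod ?m) \<noteq> \<kappa> \<and>
          side P i \<inter> side Q (if b then j else Suc j mod ?n) = {} \<and>
          side P (Suc i mod ?m) \<inter> side Q (if b then Suc j mod ?n else j) = {}"
        if "\<kappa> \<in> \<Lambda>" for \<kappa>
      proof -
        obtain i where i: "i < ?m" "g i = \<kappa>" "g (Suc i mod ?m) \<noteq> \<kappa>"
          using last_index_with_label many(2) \<open>\<kappa> \<in> \<Lambda>\<close> unfolding \<Lambda>_def by metis
        have "side P i \<inter> side Q j \<noteq> {} \<or> side P (Suc i mod ?m) \<inter> side Q j \<noteq> {}" if "j < ?n" for j
          using label i that Suc_less(1)[of i] by metis
        from hooked_corner_of_Q[OF i(1) this] obtain j where j: "j < ?n"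
          "side P i \<inter> side Q j = {} \<and> side P (Suc i mod ?m) \<inter> side Q (Suc j mod ?n) = {} \<or>
           side P (Suc i mod ?m) \<inter> side Q j = {} \<and> side P i \<inter> side Q (Suc j mod ?n) = {}"
          unfolding Let_def by blast
        obtain b where "side P i \<inter> side Q (if b then j else Suc j mod ?n) = {}"
          "side P (Suc i mod ?m) \<inter> side Q (if b then Suc j mod ?n else j) = {}"
        proof (rule disjE[OF j(2)])
          assume "side P i \<inter> side Q j = {} \<and> side P (Suc i mod ?m) \<inter> side Q (Suc j mod ?n) = {}"
          then show thesis using that[of True] by simp
        next
          assume "side P (Suc i mod ?m) \<inter> side Q j = {} \<and> side P i \<inter> side Q (Suc j mod ?n) = {}"
          then show thesis using that[of False] by simp
        qed
        then show ?thesis using i j(1) by blast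
      qed
      then obtain I' J' B' where hook': "\<And>\<kappa>. \<kappa> \<in> \<Lambda> \<Longrightarrow> I' \<kappa> < ?m \<and> J' \<kappa> < ?n \<and> g (I' \<kappa>) = \<kappa> \<and>
          g (Suc (I' \<kappa>) mod ?m) \<noteq> \<kappa> \<and>
          side P (I' \<kappa>) \<inter> side Q (if B' \<kappa> then J' \<kappa> else Suc (J' \<kappa>) mod ?n) = {} \<and>
          side P (Suc (I' \<kappa>) mod ?m) \<inter> side Q (if B' \<kappa> then Suc (J' \<kappa>) mod ?n else J' \<kappa>) = {}"
        by metis
      have "finite \<Lambda>" by (simp add: \<Lambda>_def)
      then obtain e where e: "bij_betw e {..<card \<Lambda>} \<Lambda>"
        using ex_bij_betw_nat_finite atLeast0LessThan by metis
      define I J B where "I x = I' (e x)" and "J x = J' (e x)" and "B x = B' (e x)" for x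
      define c d where "c x = (if B x then J x else Suc (J x) mod ?n)"
        and "d x = (if B x then Suc (J x) mod ?n else J x)" for x
      define \<sigma> where "\<sigma> x = g (Suc (I x) mod ?m)" for x
      define K where "K x = corner (I x) (J x) (B x)" for x
      have e_in: "e x \<in> \<Lambda>" if "x < N" for x
        using e many(1) that by (auto simp: bij_betw_def)
      have e_inj: "e x \<noteq> e y" if "x < N" "y < N" "x \<noteq> y" for x y
        using e many(1) that by (auto simp: bij_betw_def inj_on_def)
      have hook: "I x < ?m" "J x < ?n" "g (I x) = e x" "\<sigma> x \<noteq> e x"
        "side P (I x) \<inter> side Q (c x) = {}" "side P (Suc (I x) mod ?m) \<inter> side Q (d x) = {}" if "x < N" for x
        using hook'[OF e_in[OF that]] unfolding I_def J_def B_def c_def d_def \<sigma>_def by blast+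
      have cd_less: "c x < ?n" "d x < ?n" if "x < N" for x
        using hook[OF that] Suc_less by (simp_all add: c_def d_def)
      have h: "h (c x) = e x" "h (d x) = \<sigma> x" if "x < N" for x
        using label hook[OF that] cd_less[OF that] Suc_less(1)[of "I x"] by (metis \<sigma>_def)+

      define touch_P where "touch_P x y \<longleftrightarrow> (\<exists>r<3. \<exists>s<3. (I y + r) mod ?m = (I x + s) mod ?m)" for x y
      define touch_Q where "touch_Q x y \<longleftrightarrow> (\<exists>r<3. \<exists>s<3. (J y + r) mod ?n = (J x + s) mod ?n)" for x y
      define pick where "pick x y p = K (if snd p then y else x) (fst p)" for x y and p :: "nat \<times> bool"
      define col where "col x y = ({(p, q, r). p \<in> A \<and> q \<in> A \<and> r \<in> A \<and> ccw (pick x y p) (pick x y q) (pick x y r)},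
        touch_P x y, touch_Q x y, \<sigma> x = e y, \<sigma> y = e x)" for x y
      have "\<forall>x y. col x y \<in> T" by (auto simp: col_def T_def)
      with ramsey[THEN spec, of col] obtain H k where
        "H \<subseteq> {..<N} \<and> card H = 20 \<and> (\<forall>x\<in>H. \<forall>y\<in>H. x < y \<longrightarrow> col x y = k)"
        by blast
      then have H: "H \<subseteq> {..<N}" "card H = 20"
        and mono: "\<And>x y. x \<in> H \<Longrightarrow> y \<in> H \<Longrightarrow> x < y \<Longrightarrow> col x y = k" by blast+
      have fin: "finite H" using H(1) finite_subset by blast
      have HN: "x < N" if "x \<in> H" for x using H(1) that by auto
      obtain x0 x1 x2 where x: "x0 \<in> H" "x1 \<in> H" "x2 \<in> H" "x0 < x1" "x1 < x2"
        using three_increasing_elements[of H] H(2) by auto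
      have same: "col x y = col x0 x1" if "x \<in> H" "y \<in> H" "x < y" for x y
        using mono that x by metis

      have not_all_touch: False
        if all: "\<And>y. y \<in> H \<Longrightarrow> Min H < y \<Longrightarrow> \<exists>r<3. \<exists>s<3. (f y + r) mod l = (f (Min H) + s) mod l"
          and f: "\<And>y. y \<in> H \<Longrightarrow> f y < l" and inj: "inj_on (\<lambda>y. (f y, b y)) H"
        for f :: "nat \<Rightarrow> nat" and l and b :: "nat \<Rightarrow> bool"
      proof -
        have "card (H - {Min H}) \<le> 18"
        proof (rule window_degree)
          show "inj_on (\<lambda>y. (f y, b y)) (H - {Min H})" using inj by (rule inj_on_subset) blast
          show "\<exists>r<3. \<exists>s<3. (f y + r) mod l = (f (Min H) + s) mod l" if "y \<in> H - {Min H}" for y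
          proof (rule all)
            show "y \<in> H" using that by simp
            show "Min H < y" using that Min_le[OF fin, of y] by auto
          qed
        qed (use f in auto)
        moreover have "Min H \<in> H" using x fin by (intro Min_in) auto
        ultimately show False using H(2) fin by simp
      qed
      have MinH: "Min H \<in> H" using x fin by (intro Min_in) auto
      have "\<not> touch_P x0 x1"
      proof
        assume "touch_P x0 x1"
        then have "touch_P (Min H) y" if "y \<in> H" "Min H < y" for y
          using same[OF MinH that] by (simp add: col_def)
        moreover have "inj_on (\<lambda>y. (I y, True)) H"
        proof (rule inj_onI)
          fix y z assume yz: "y \<in> H" "z \<in> H" "(I y, True) = (I z, True)"
          then have "e y = e z" using hook(3)[OF HN] by (metis prod.inject)
          then show "y = z" using e_inj HN yz by blast
        qed
        ultimately show False
          using not_all_touch[of I ?m "\<lambda>_. True"] hook(1)[OF HN] by (simp add: touch_P_def)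
      qed
      moreover have "\<not> touch_Q x0 x1"
      proof
        assume "touch_Q x0 x1"
        then have "touch_Q (Min H) y" if "y \<in> H" "Min H < y" for y
          using same[OF MinH that] by (simp add: col_def)
        moreover have "inj_on (\<lambda>y. (J y, B y)) H"
        proof (rule inj_onI)
          fix y z assume yz: "y \<in> H" "z \<in> H" "(J y, B y) = (J z, B z)"
          then have "c y = c z" by (simp add: c_def)
          then have "e y = e z" using h(1)[OF HN] yz by metis
          then show "y = z" using e_inj HN yz by blast
        qed
        ultimately show False
          using not_all_touch[of J ?n B] hook(2)[OF HN] by (simp add: touch_Q_def)
      qed
      moreover have "\<sigma> x0 \<noteq> e x1"
      proof
        assume "\<sigma> x0 = e x1"
        then have "\<sigma> x0 = e x2" using same[of x0 x2] x by (simp add: col_def)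
        then show False using \<open>\<sigma> x0 = e x1\<close> e_inj[of x1 x2] x HN by simp
      qed
      moreover have "\<sigma> x1 \<noteq> e x0"
      proof
        assume "\<sigma> x1 = e x0"
        then have "\<sigma> x2 = e x0" "\<sigma> x2 = e x1" using same[of x0 x2] same[of x1 x2] x by (simp_all add: col_def)
        then show False using e_inj[of x0 x1] x HN by simp
      qed
      ultimately have apart: "\<not> touch_P x y" "\<not> touch_Q x y" "\<sigma> x \<noteq> e y" "\<sigma> y \<noteq> e x"
        if "x \<in> H" "y \<in> H" "x < y" for x y
        using same[OF that] by (auto simp: col_def)
      have apart': "\<not> touch_P x y" "\<not> touch_Q x y" "\<sigma> x \<noteq> e y" "e x \<noteq> \<sigma> y" "e x \<noteq> e y"
        if "x \<in> H" "y \<in> H" "x \<noteq> y" for x y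
      proof -
        have sym: "touch_P x y = touch_P y x" "touch_Q x y = touch_Q y x"
          unfolding touch_P_def touch_Q_def by metis+
        show "\<not> touch_P x y" "\<not> touch_Q x y" "\<sigma> x \<noteq> e y" "e x \<noteq> \<sigma> y" "e x \<noteq> e y"
          using apart[of x y] apart[of y x] that sym e_inj[of x y] HN by (metis linorder_neqE_nat)+
      qed

      define z where "z i = [x0, x1, x2] ! i" for i :: nat
      have z: "z i \<in> H" if "i < 3" for i
        using that x by (auto simp: z_def less_Suc_eq numeral_3_eq_3)
      have z_mono: "z i < z j" if "i < j" "j < 3" for i j
        using that x by (auto simp: z_def less_Suc_eq numeral_3_eq_3)
      have z_neq: "z i \<noteq> z j" if "i < 3" "j < 3" "i \<noteq> j" for i j
        using z_mono[of i j] z_mono[of j i] that by linarith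
      have zN: "z i < N" if "i < 3" for i using z[OF that] HN by blast
      show False
      proof (rule no_homogeneous_hooks[of "\<lambda>i. I (z i)" "\<lambda>i. J (z i)" "\<lambda>i. B (z i)"])
        fix i j :: nat assume i: "i < 3"
        show "I (z i) < ?m" "J (z i) < ?n" using hook zN i by blast+
        show "side P (I (z i)) \<inter> side Q (if B (z i) then J (z i) else Suc (J (z i)) mod ?n) = {} \<and>
          side P (Suc (I (z i)) mod ?m) \<inter> side Q (if B (z i) then Suc (J (z i)) mod ?n else J (z i)) = {}"
          using hook(5,6)[OF zN[OF i]] by (simp add: c_def d_def)
        assume j: "j < 3"
        have \<sigma>_neq: "\<sigma> (z i) \<noteq> e (z j)" "\<sigma> (z j) \<noteq> e (z i)"
          using apart'[of "z i" "z j"] z z_neq hook(4)[OF zN] i j by (metis)+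
        note zi = zN[OF i] and zj = zN[OF j]
        show "side P (I (z i)) \<inter> side Q (if B (z j) then Suc (J (z j)) mod ?n else J (z j)) \<noteq> {}"
          using label hook(1,3)[OF zi] cd_less(2)[OF zj] h(2)[OF zj] \<sigma>_neq(2) by (metis d_def)
        show "side P (Suc (I (z i)) mod ?m) \<inter> side Q (if B (z j) then J (z j) else Suc (J (z j)) mod ?n) \<noteq> {}"
          using label Suc_less(1)[of "I (z i)"] cd_less(1)[OF zj] h(1)[OF zj] \<sigma>_neq(1) by (metis c_def \<sigma>_def)
        assume ij: "i \<noteq> j"
        have zij: "z i \<noteq> z j" using z_neq i j ij by blast
        show "side P (I (z i)) \<inter> side Q (if B (z j) then J (z j) else Suc (J (z j)) mod ?n) \<noteq> {}"
          using label hook(1,3)[OF zi] cd_less(1)[OF zj] h(1)[OF zj] apart'(5)[OF z[OF i] z[OF j] zij] by (metis c_def)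
        show "(I (z i) + r) mod ?m \<noteq> (I (z j) + s) mod ?m" "(J (z i) + r) mod ?n \<noteq> (J (z j) + s) mod ?n"
          if "r < 3" "s < 3" for r s
          using apart'(1,2)[OF z[OF j] z[OF i] zij[symmetric]] that by (auto simp: touch_P_def touch_Q_def)
      next
        fix i j s t u :: nat and b1 b2 b3 :: bool
        assume ij: "i < j" "j < 3" and stu: "s < 6" "t < 6" "u < 6"
        have "fst (col (z i) (z j)) = fst (col (z 0) (z 1))"
          using same[OF z z z_mono[OF ij]] ij by (simp add: z_def)
        then have "((s, b1), (t, b2), (u, b3)) \<in> fst (col (z i) (z j)) \<longleftrightarrow>
          ((s, b1), (t, b2), (u, b3)) \<in> fst (col (z 0) (z 1))" by simp
        then have "ccw (pick (z i) (z j) (s, b1)) (pick (z i) (z j) (t, b2)) (pick (z i) (z j) (u, b3)) =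
          ccw (pick (z 0) (z 1) (s, b1)) (pick (z 0) (z 1) (t, b2)) (pick (z 0) (z 1) (u, b3))"
          using stu by (simp add: col_def A_def del: One_nat_def)
        then show "ccw (corner (I (z (if b1 then j else i))) (J (z (if b1 then j else i))) (B (z (if b1 then j else i))) s)
           (corner (I (z (if b2 then j else i))) (J (z (if b2 then j else i))) (B (z (if b2 then j else i))) t)
           (corner (I (z (if b3 then j else i))) (J (z (if b3 then j else i))) (B (z (if b3 then j else i))) u) =
          ccw (corner (I (z (if b1 then 1 else 0))) (J (z (if b1 then 1 else 0))) (B (z (if b1 then 1 else 0))) s)
           (corner (I (z (if b2 then 1 else 0))) (J (z (if b2 then 1 else 0))) (B (z (if b2 then 1 else 0))) t)
           (corner (I (z (if b3 then 1 else 0))) (J (z (if b3 then 1 else 0))) (B (z (if b3 then 1 else 0))) u)"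
          by (simp add: pick_def K_def if_distrib[of z])
      qed
    qed
  qed
qed

theorem theorem1:
  "\<exists>C::int. \<forall>(m::nat) (n::nat) (P::(real^2) list) (Q::(real^2) list).
     3 \<le> m \<and> odd m \<and> 3 \<le> n \<and> odd n \<and>
     length P = m \<and> length Q = n \<and>
     simple_polygon P \<and> simple_polygon Q \<and> general_position P Q \<longrightarrow>
       int (card {(p, q). p \<in> sides P \<and> q \<in> sides Q \<and> p \<inter> q = {}}) \<ge> int m + int n - C \<and>
       finite (boundary P \<inter> boundary Q) \<and>
       int (card (boundary P \<inter> boundary Q)) \<le> int m * int n - (int m + int n) + C"
proof -
  obtain N where N: "\<And>P Q. \<And>g h :: nat \<Rightarrow> nat + nat. odd_polygon_pair P Q \<Longrightarrow>
    (\<forall>i<length P. \<forall>j<length Q. g i \<noteq> h j \<longrightarrow> side P i \<inter> side Q j \<noteq> {}) \<Longrightarrow>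
    card (g ` {..<length P}) \<le> N"
    using bounded_number_of_labels[where 'b = "nat + nat"] by blast
  show ?thesis
  proof (intro exI[of _ "int N"] allI impI)
    fix m n :: nat and P Q :: "(real^2) list"
    assume "3 \<le> m \<and> odd m \<and> 3 \<le> n \<and> odd n \<and> length P = m \<and> length Q = n \<and>
      simple_polygon P \<and> simple_polygon Q \<and> general_position P Q"
    then have m: "length P = m" and n: "length Q = n" and pair: "odd_polygon_pair P Q"
      by (auto intro: odd_polygon_pair.intro)
    interpret odd_polygon_pair P Q by fact
    define D where "D = {(i, j). i < m \<and> j < n \<and> side P i \<inter> side Q j = {}}"
    have D_sub: "D \<subseteq> {..<m} \<times> {..<n}" by (auto simp: D_def)
    then have fin_D: "finite D" by (rule finite_subset) simp

    define V where "V = {..<m} <+> {..<n}"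
    define E :: "((nat + nat) \<times> (nat + nat)) set" where "E = (\<lambda>(i, j). (Inl i, Inr j)) ` D"
    have "inj_on (\<lambda>(i, j). (Inl i :: nat + nat, Inr j :: nat + nat)) D" by (auto simp: inj_on_def)
    then have card_E: "card E = card D" unfolding E_def by (rule card_image)
    have "E \<subseteq> V \<times> V" by (auto simp: E_def D_def V_def)
    then obtain f :: "nat + nat \<Rightarrow> nat + nat"
      where f: "\<forall>(x, y)\<in>E. f x = f y" "card V \<le> card E + card (f ` V)"
      using labelling_with_few_edges[of E V] fin_D by (auto simp: E_def V_def)
    have f_eq: "f (Inl i) = f (Inr j)" if "(i, j) \<in> D" for i j using f(1) that by (auto simp: E_def)
    have "f ` V \<subseteq> (\<lambda>i. f (Inl i)) ` {..<m}"
    proof (rule image_subsetI)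
      fix v assume "v \<in> V"
      then consider i where "v = Inl i" "i < m" | j where "v = Inr j" "j < n" by (auto simp: V_def)
      then show "f v \<in> (\<lambda>i. f (Inl i)) ` {..<m}"
      proof cases
        case 2
        then obtain i where "i < m" "side Q j \<inter> side P i = {}"
          using odd_polygon_pair.ex_disjoint_side[OF odd_polygon_pair_swap] m n by blast
        then have "(i, j) \<in> D" using 2 by (auto simp: D_def)
        then have "f v = f (Inl i)" using f_eq 2 by simp
        then show ?thesis using \<open>i < m\<close> by (intro image_eqI[where x = i]) simp_all
      qed auto
    qed
    then have "card (f ` V) \<le> card ((\<lambda>i. f (Inl i)) ` {..<m})" by (intro card_mono) auto
    also have "\<dots> \<le> N"
    proof -
      have "\<forall>i<length P. \<forall>j<length Q. f (Inl i) \<noteq> f (Inr j) \<longrightarrow> side P i \<inter> side Q j \<noteq> {}"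
        using f_eq by (auto simp: D_def m n)
      from N[OF pair this] show ?thesis by (simp add: m)
    qed
    finally have card_D: "m + n \<le> card D + N"
      using f(2) card_E by (simp add: V_def card_Plus)

    have "{(p, q). p \<in> sides P \<and> q \<in> sides Q \<and> p \<inter> q = {}} = map_prod (side P) (side Q) ` D"
      by (auto simp: sides_def D_def m n image_iff)
    moreover have "inj_on (map_prod (side P) (side Q)) D"
      using inj_on_subset[OF map_prod_inj_on[OF inj_on_side[OF simple_P] inj_on_side[OF simple_Q]]] D_sub m n
      by blast
    ultimately have pairs: "card {(p, q). p \<in> sides P \<and> q \<in> sides Q \<and> p \<inter> q = {}} = card D"
      by (simp add: card_image)

    have single: "finite (side P i \<inter> side Q j) \<and> card (side P i \<inter> side Q j) \<le> 1" if "i < m" "j < n" for i j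
    proof -
      have ij: "i < length P" "j < length Q" using that m n by simp_all
      have "Q ! j \<noteq> P ! i" "Q ! j \<noteq> next_vertex P i"
        using distinct_vertices(3) next_vertex_in(1)[OF ij(1)] nth_mem[OF ij(1)] nth_mem[OF ij(2)] by auto
      then have "orient (P ! i) (next_vertex P i) (Q ! j) \<noteq> 0"
        using next_vertex_in(1)[OF ij(1)] next_vertex_neq(1)[OF ij(1)] ij by (intro orient_nonzero) auto
      then have "x = y" if "x \<in> side P i \<inter> side Q j" "y \<in> side P i \<inter> side Q j" for x y
        using segments_meet_once that unfolding side_def by blast
      then have "side P i \<inter> side Q j = {} \<or> (\<exists>x. side P i \<inter> side Q j = {x})" by blast
      then show ?thesis by auto
    qed
    define M where "M = {..<m} \<times> {..<n} - D"
    have "boundary P \<inter> boundary Q = (\<Union>(i, j)\<in>M. side P i \<inter> side Q j)"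
      by (auto simp: boundary_def sides_def M_def D_def m n)
    moreover have "finite M" by (simp add: M_def)
    moreover have "card (\<Union>(i, j)\<in>M. side P i \<inter> side Q j) \<le> (\<Sum>(i, j)\<in>M. card (side P i \<inter> side Q j))"
      using card_UN_le[OF \<open>finite M\<close>, of "\<lambda>(i, j). side P i \<inter> side Q j"] by (simp add: case_prod_unfold)
    moreover have "(\<Sum>(i, j)\<in>M. card (side P i \<inter> side Q j)) \<le> (\<Sum>(i, j)\<in>M. 1)"
      using single by (intro sum_mono) (auto simp: M_def)
    moreover have "finite (\<Union>(i, j)\<in>M. side P i \<inter> side Q j)"
      using single \<open>finite M\<close> by (auto simp: M_def)
    moreover have "card M + card D = m * n"
      using D_sub fin_D card_mono[OF _ D_sub] by (simp add: M_def card_Diff_subset card_cartesian_product)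
    ultimately have "finite (boundary P \<inter> boundary Q)" "card (boundary P \<inter> boundary Q) + card D \<le> m * n"
      by (auto simp: case_prod_unfold)
    then show "int (card {(p, q). p \<in> sides P \<and> q \<in> sides Q \<and> p \<inter> q = {}}) \<ge> int m + int n - int N \<and>
       finite (boundary P \<inter> boundary Q) \<and>
       int (card (boundary P \<inter> boundary Q)) \<le> int m * int n - (int m + int n) + int N"
      using card_D pairs by (simp flip: of_nat_add of_nat_mult)
  qed
qed

end
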